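(* Let $\mathsf{A}=(A_1,\dots,A_N)$ be a tuple of $d\times d$ real matrices with $\Lambda(\mathsf{A})=0$ which admits a Barabanov norm $\lVert\!|\cdot|\!\rVert$. Suppose also that $d$ is odd and that every convex combination of $A_1,\dots,A_N$ is nonsingular. Then there exist two distinct trajectories of the linear switched system defined by $\mathsf{A}$ which are extremal with respect to $\lVert\!|\cdot|\!\rVert$ and which have the same initial state.
   Context: A trajectory of the linear switched system defined by $\mathsf{A}$ is an absolutely continuous $x\colon[0,\infty)\to\mathbb{R}^d$ with $\dot x(t)=\sum_{i=1}^N u_i(t)A_ix(t)$ a.e., where $u_i\colon[0,\infty)\to[0,1]$ are Lebesgue measurable with $\sum_iu_i=1$ a.e. The uniform exponential rate is $\Lambda(\mathsf{A})\coloneq\lim_{t\to\infty}\frac1t\sup_{x(0)\ne0}\log(\|x(t)\|/\|x(0)\|)$, the supremum over all nonzero trajectories. A Barabanov norm for $\mathsf{A}$ is a norm $\lVert\!|\cdot|\!\rVert$ on $\mathbb{R}^d$ such that every unit vector (for this norm) is the initial point of at least one trajectory which remains in the unit sphere of $\lVert\!|\cdot|\!\rVert$ for all time; such a trajectory is called extremal with respect to $\lVert\!|\cdot|\!\rVert$. *)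

theory Defs
  imports "HOL-Analysis.Analysis"
begin

definition abs_continuous_on :: "real set \<Rightarrow> (real \<Rightarrow> 'a::real_normed_vector) \<Rightarrow> bool" where
  "abs_continuous_on S f \<longleftrightarrow>
     (\<forall>e>0. \<exists>\<delta>>0. \<forall>(n::nat) (a::nat \<Rightarrow> real) b.
        (\<forall>k<n. a k \<le> b k \<and> {a k..b k} \<subseteq> S) \<and>
        disjoint_family_on (\<lambda>k. {a k<..<b k}) {..<n} \<and>
        (\<Sum>k<n. b k - a k) < \<delta>
        \<longrightarrow> (\<Sum>k<n. norm (f (b k) - f (a k))) < e)"

text \<open>Trajectory of the linear switched system defined by the tuple A (indexed by the
  finite type 'i, so N = CARD('i)). Absolute continuity on [0,\<infinity>) is read as absolute
  continuity on every compact subinterval [0,T].\<close>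
definition trajectory :: "('i::finite \<Rightarrow> real^'d^'d) \<Rightarrow> (real \<Rightarrow> real^'d) \<Rightarrow> bool" where
  "trajectory A x \<longleftrightarrow>
     (\<forall>T\<ge>0. abs_continuous_on {0..T} x) \<and>
     (\<exists>u :: 'i \<Rightarrow> real \<Rightarrow> real.
        (\<forall>i. u i \<in> borel_measurable (lebesgue_on {0..})) \<and>
        (\<forall>i. \<forall>t\<ge>0. 0 \<le> u i t \<and> u i t \<le> 1) \<and>
        (AE t in lebesgue_on {0..}. (\<Sum>i\<in>UNIV. u i t) = 1) \<and>
        (AE t in lebesgue_on {0..}.
           (x has_vector_derivative (\<Sum>i\<in>UNIV. u i t *\<^sub>R (A i *v x t))) (at t within {0..})))"

definition growth_sup :: "('i::finite \<Rightarrow> real^'d^'d) \<Rightarrow> real \<Rightarrow> real" where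
  "growth_sup A t = Sup {ln (norm (x t) / norm (x 0)) | x. trajectory A x \<and> x 0 \<noteq> 0}"

definition has_uniform_rate :: "('i::finite \<Rightarrow> real^'d^'d) \<Rightarrow> real \<Rightarrow> bool" where
  "has_uniform_rate A L \<longleftrightarrow> ((\<lambda>t. growth_sup A t / t) \<longlongrightarrow> L) at_top"

definition is_norm :: "(real^'d \<Rightarrow> real) \<Rightarrow> bool" where
  "is_norm f \<longleftrightarrow> (\<forall>v. 0 \<le> f v) \<and> (\<forall>v. f v = 0 \<longleftrightarrow> v = 0) \<and>
     (\<forall>c v. f (c *\<^sub>R v) = \<bar>c\<bar> * f v) \<and> (\<forall>v w. f (v + w) \<le> f v + f w)"

definition extremal :: "('i::finite \<Rightarrow> real^'d^'d) \<Rightarrow> (real^'d \<Rightarrow> real) \<Rightarrow> (real \<Rightarrow> real^'d) \<Rightarrow> bool" where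
  "extremal A f x \<longleftrightarrow> trajectory A x \<and> (\<forall>t\<ge>0. f (x t) = 1)"

definition barabanov_norm :: "('i::finite \<Rightarrow> real^'d^'d) \<Rightarrow> (real^'d \<Rightarrow> real) \<Rightarrow> bool" where
  "barabanov_norm A f \<longleftrightarrow> is_norm f \<and>
     (\<forall>v. f v = 1 \<longrightarrow> (\<exists>x. x 0 = v \<and> extremal A f x))"

end

theory Submission
  imports Defs "HOL-Homology.Homology" "HOL-Combinatorics.Permutations"
    "HOL-Complex_Analysis.Great_Picard"
begin

text \<open>
  Suppose that every unit vector \<open>v\<close> of the Barabanov norm is the initial point of exactly one
  extremal trajectory \<open>\<phi> v\<close>. Limits of extremal trajectories are extremal, so uniqueness makes
  \<open>v \<mapsto> \<phi> v h\<close> a continuous self-map of the unit sphere for every \<open>h > 0\<close>. As \<open>d\<close> is odd, the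
  sphere has even dimension, on which the identity and the antipodal map have different degrees;
  hence some \<open>\<phi> v h\<close> is \<open>v\<close> or \<open>- v\<close>. For small \<open>h\<close> the latter is excluded by the
  Lipschitz bound, and the former because \<open>\<phi> v h - v\<close> equals \<open>h\<close> times a convex combination of
  the \<open>A\<^sub>i v\<close> up to an error of order \<open>h\<^sup>2\<close>, while the convex combinations of the matrices are
  uniformly nonsingular.

  Closure of the trajectories under limits is obtained without weak compactness of controls: a
  trajectory \<open>x\<close> is recorded together with the integral \<open>U\<close> of its control through the inequality
  \<open>\<bar>x t - x s - \<Sum>\<^sub>i (U\<^sub>i t - U\<^sub>i s) A\<^sub>i x s\<bar> \<le> C (t - s)\<^sup>2\<close>, which survives pointwise limits, and
  from which \<open>x' = \<Sum>\<^sub>i U\<^sub>i' A\<^sub>i x\<close> is recovered wherever all the \<open>U\<^sub>i\<close> are differentiable, that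
  is, almost everywhere.
\<close>

section \<open>Degree of the antipodal map and radial directions\<close>

lemma continuous_map_nsphere_permute:
  assumes "\<sigma> permutes {..p}"
  shows "continuous_map (nsphere p) (nsphere p) (\<lambda>x. x \<circ> \<sigma>)"
proof -
  have sum: "(\<Sum>i\<le>p. (x (\<sigma> i))\<^sup>2) = (\<Sum>i\<le>p. (x i)\<^sup>2)" for x :: "nat \<Rightarrow> real"
    using sum.permute[OF assms, of "\<lambda>i. (x i)\<^sup>2"] by (simp add: o_def)
  have out: "\<sigma> i = i" if "i > p" for i
    using assms that by (auto simp: permutes_def)
  show ?thesis
    unfolding nsphere
    by (auto simp: continuous_map_in_subtopology continuous_map_componentwise_UNIV sum out
        intro!: continuous_map_from_subtopology continuous_map_product_projection)
qed

lemma continuous_map_nsphere_negate: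
  "continuous_map (nsphere p) (nsphere p) (\<lambda>x i. if i \<in> I then - x i else x i)"
proof -
  have eq: "(if i \<in> I then - x i else x i)\<^sup>2 = (x i)\<^sup>2" for i and x :: "nat \<Rightarrow> real"
    by auto
  have proj: "continuous_map (powertop_real UNIV) euclideanreal (\<lambda>x. x k)" for k :: nat
    by (intro continuous_map_product_projection) simp
  have "continuous_map (powertop_real UNIV) euclideanreal (\<lambda>x. if k \<in> I then - x k else x k)" for k
    using proj[of k] continuous_map_minus[OF proj[of k]] by (cases "k \<in> I") simp_all
  then show ?thesis
    unfolding nsphere continuous_map_in_subtopology continuous_map_componentwise_UNIV
    by (intro conjI allI continuous_map_from_subtopology) (auto simp: eq)
qed

text \<open>Conjugation by the transposition of coordinates 0 and \<open>j\<close> carries the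
  reflection in coordinate 0 to the one in \<open>j\<close>. The swap is an involution, so its
  degree squares to 1 and drops out of the product.\<close>

lemma Brouwer_degree2_coordinate_reflection:
  assumes "j \<le> p"
  shows "Brouwer_degree2 p (\<lambda>x i. if i = j then - x i else x i) = -1"
proof -
  define sw where "sw = (\<lambda>x::nat \<Rightarrow> real. x \<circ> Transposition.transpose 0 j)"
  define r :: "nat \<Rightarrow> (nat \<Rightarrow> real) \<Rightarrow> nat \<Rightarrow> real" where "r = (\<lambda>k x i. if i = k then - x i else x i)"
  have sw: "continuous_map (nsphere p) (nsphere p) sw"
    unfolding sw_def using assms by (intro continuous_map_nsphere_permute permutes_swap_id) auto
  have r: "continuous_map (nsphere p) (nsphere p) (r k)" for k
    using continuous_map_nsphere_negate[of p "{k}"] by (simp add: r_def)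
  have "sw \<circ> sw = id"
    by (auto simp: sw_def fun_eq_iff)
  then have 1: "Brouwer_degree2 p sw * Brouwer_degree2 p sw = 1"
    using Brouwer_degree2_compose[OF sw sw] by simp
  have "r j = sw \<circ> (r 0 \<circ> sw)"
    by (auto simp: sw_def r_def fun_eq_iff Transposition.transpose_def)
  then have "Brouwer_degree2 p (r j) = Brouwer_degree2 p sw * (Brouwer_degree2 p (r 0) * Brouwer_degree2 p sw)"
    using Brouwer_degree2_compose[OF sw r] Brouwer_degree2_compose[OF continuous_map_compose[OF sw r] sw]
    by simp
  also have "\<dots> = -1"
    using 1 Brouwer_degree2_reflection[of p] by (simp add: r_def)
  finally show ?thesis
    by (simp add: r_def)
qed

text \<open>The sphere \<open>nsphere p\<close> lies in the coordinates \<open>0..p\<close>, so its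
  antipodal map is a composite of \<open>Suc p\<close> coordinate reflections, and degrees
  multiply.\<close>

lemma Brouwer_degree2_antipodal:
  "Brouwer_degree2 p (\<lambda>x i. - x i) = (-1) ^ Suc p"
proof -
  let ?neg = "\<lambda>k (x::nat \<Rightarrow> real) i. if i \<in> {..<k} then - x i else x i"
  have "Brouwer_degree2 p (?neg k) = (-1) ^ k" if "k \<le> Suc p" for k
    using that
  proof (induction k)
    case 0
    have "?neg 0 = id" by (auto simp: fun_eq_iff)
    then show ?case by simp
  next
    case (Suc k)
    let ?r = "\<lambda>(x::nat \<Rightarrow> real) i. if i \<in> {k} then - x i else x i"
    have "?neg (Suc k) = ?r \<circ> ?neg k"
      by (auto simp: fun_eq_iff less_Suc_eq)
    moreover have "Brouwer_degree2 p ?r = -1"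
      using Brouwer_degree2_coordinate_reflection[of k p] Suc.prems by simp
    ultimately show ?case
      using Suc Brouwer_degree2_compose[OF continuous_map_nsphere_negate[of p "{..<k}"]
        continuous_map_nsphere_negate[of p "{k}"]] by simp
  qed
  then have deg: "Brouwer_degree2 p (?neg (Suc p)) = (-1) ^ Suc p"
    by blast
  \<comment> \<open>As functions the two maps differ beyond coordinate \<open>p\<close>; on the
    sphere those coordinates vanish, so the maps agree there.\<close>
  have "homotopic_with (\<lambda>x. True) (nsphere p) (nsphere p) (?neg (Suc p)) (\<lambda>x i. - x i)"
  proof (rule homotopic_with_equal)
    show "continuous_map (nsphere p) (nsphere p) (?neg (Suc p))"
      by (rule continuous_map_nsphere_negate)
  qed (auto simp: nsphere fun_eq_iff not_less)
  then have "Brouwer_degree2 p (?neg (Suc p)) = Brouwer_degree2 p (\<lambda>x i. - x i)"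
    by (rule Brouwer_degree2_homotopic)
  with deg show ?thesis
    by (rule subst[rotated])
qed

text \<open>If \<open>G u\<close> were never a real multiple of \<open>u\<close>, the segments from
  \<open>u\<close> and from \<open>- u\<close> to \<open>G u\<close> would avoid the origin.
  Identity and antipodal map would then both be homotopic to \<open>G\<close> in the punctured
  space, hence to each other on the sphere, although in odd dimension their degrees are 1 and
  -1.\<close>

theorem hairy_ball_radial_direction:
  fixes G :: "'n::euclidean_space \<Rightarrow> 'n"
  assumes odd: "odd DIM('n)" and G: "continuous_on (sphere 0 1) G"
  obtains u c where "norm u = 1" "G u = c *\<^sub>R u"
proof (rule ccontr)
  assume "\<not> thesis"
  then have nonrad: "\<forall>u c. norm u = 1 \<longrightarrow> G u \<noteq> c *\<^sub>R u"
    using that by blast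
  define p where "p = DIM('n) - 1"
  have p: "Suc p = DIM('n)"
    by (simp add: p_def)
  obtain b where b: "bij_betw b {..<DIM('n)} (Basis :: 'n set)"
    using ex_bij_betw_nat_finite[of "Basis::'n set"] by (auto simp: lessThan_atLeast0)
  have b': "b i \<in> Basis" if "i \<le> p" for i
    using bij_betwE[OF b] that p by auto
  have ortho: "b i \<bullet> b j = (if i = j then 1 else 0)" if "i \<le> p" "j \<le> p" for i j
    using b' that p bij_betw_imp_inj_on[OF b] by (auto simp: inner_Basis inj_on_eq_iff)
  \<comment> \<open>\<open>F\<close> and \<open>K\<close> translate between \<open>nsphere p\<close>
    and the Euclidean unit sphere through an orthonormal basis; \<open>N\<close> retracts the
    punctured space onto that sphere.\<close>
  define F where "F = (\<lambda>x::nat \<Rightarrow> real. \<Sum>i\<le>p. x i *\<^sub>R b i)"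
  define K where "K = (\<lambda>(u::'n) i. if i \<le> p then u \<bullet> b i else (0::real))"
  define N where "N = (\<lambda>u::'n. u /\<^sub>R norm u)"
  have bF: "F x \<bullet> b j = x j" if "j \<le> p" for x j
    using that by (simp add: F_def inner_sum_left ortho if_distrib cong: if_cong)
  have normK: "(\<Sum>i\<le>p. (u \<bullet> b i)\<^sup>2) = (norm u)\<^sup>2" for u
  proof -
    have "(\<Sum>i\<le>p. (u \<bullet> b i)\<^sup>2) = (\<Sum>i<DIM('n). (u \<bullet> b i)\<^sup>2)"
      unfolding p[symmetric] lessThan_Suc_atMost ..
    also have "\<dots> = (\<Sum>v\<in>Basis. (u \<bullet> v)\<^sup>2)"
      by (rule sum.reindex_bij_betw[OF b])
    finally show ?thesis
      unfolding power2_norm_eq_inner using euclidean_inner[of u u] by (simp only: power2_eq_square)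
  qed
  have normF: "norm (F x) = 1" if "x \<in> topspace (nsphere p)" for x
  proof -
    have "(norm (F x))\<^sup>2 = (\<Sum>i\<le>p. (x i)\<^sup>2)"
      unfolding normK[symmetric] by (simp add: bF)
    also have "\<dots> = 1"
      using that by (simp add: nsphere)
    finally show ?thesis
      by (metis norm_ge_zero one_power2 power2_eq_imp_eq zero_le_one)
  qed
  have KF: "K (F x) = x" if "x \<in> topspace (nsphere p)" for x
    using that by (auto simp: K_def bF nsphere fun_eq_iff)
  have contF: "continuous_map (nsphere p) (top_of_set (sphere 0 1)) F"
  proof -
    have "continuous_map (nsphere p) euclidean (\<lambda>x. x i *\<^sub>R b i)" for i
    proof -
      have "continuous_map (nsphere p) euclidean ((\<lambda>r. r *\<^sub>R b i) \<circ> (\<lambda>x. x i))"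
        by (rule continuous_map_compose[OF continuous_map_nsphere_projection])
           (auto intro!: continuous_intros)
      then show ?thesis
        by (simp add: o_def)
    qed
    then have "continuous_map (nsphere p) euclidean F"
      unfolding F_def by (intro continuous_map_sum) auto
    then show ?thesis
      using normF by (auto simp: continuous_map_in_subtopology)
  qed
  have contK: "continuous_map (top_of_set (sphere 0 1)) (nsphere p) K"
  proof -
    have "continuous_on (sphere 0 1) (\<lambda>u. K u i)" for i
      by (cases "i \<le> p") (auto simp: K_def intro!: continuous_intros)
    then show ?thesis
      unfolding nsphere
      by (auto simp: continuous_map_in_subtopology continuous_map_componentwise_UNIV) (auto simp: K_def normK)
  qed
  have contN: "continuous_map (top_of_set (- {0})) (top_of_set (sphere 0 1)) N"
    by (auto simp: N_def continuous_map_in_subtopology intro!: continuous_intros)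
  \<comment> \<open>Straight-line homotopy, used with \<open>s = 1\<close> and
    \<open>s = -1\<close>. A zero of the segment at \<open>t \<noteq> 0\<close> would exhibit
    \<open>G u\<close> as a multiple of \<open>u\<close>; at \<open>t = 0\<close> the point is
    \<open>s *\<^sub>R u\<close>.\<close>
  have hom1: "homotopic_with_canon (\<lambda>_. True) (sphere 0 1) (- {0}) (\<lambda>u. s *\<^sub>R u) G" if "s \<noteq> 0" for s :: real
  proof (rule homotopic_with_linear)
    fix u :: 'n assume u: "u \<in> sphere 0 1"
    have "(1 - t) *\<^sub>R s *\<^sub>R u + t *\<^sub>R G u \<noteq> 0" for t
    proof (cases "t = 0")
      case True
      then show ?thesis using u \<open>s \<noteq> 0\<close> by auto
    next
      case False
      show ?thesis
      proof
        assume "(1 - t) *\<^sub>R s *\<^sub>R u + t *\<^sub>R G u = 0"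
        then have "t *\<^sub>R G u = (- (1 - t) * s) *\<^sub>R u"
          by (metis add.commute eq_neg_iff_add_eq_0 mult_minus_left scaleR_minus_left scaleR_scaleR)
        then have "G u = (- (1 - t) * s / t) *\<^sub>R u"
          using False by (metis divide_inverse_commute pth_5 right_inverse scaleR_one scaleR_scaleR mult.commute)
        then show False
          using nonrad u by auto
      qed
    qed
    then show "closed_segment (s *\<^sub>R u) (G u) \<subseteq> - {0}"
      by (auto simp: closed_segment_def)
  qed (auto intro!: continuous_intros G)
  define P where "P = (\<lambda>u::'n. 1 *\<^sub>R u)"
  define M where "M = (\<lambda>u::'n. (-1) *\<^sub>R u)"
  have "homotopic_with_canon (\<lambda>_. True) (sphere 0 1) (- {0}) P G"
    unfolding P_def by (rule hom1) simp
  moreover have "homotopic_with_canon (\<lambda>_. True) (sphere 0 1) (- {0}) M G"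
    unfolding M_def by (rule hom1) simp
  ultimately have "homotopic_with_canon (\<lambda>_. True) (sphere 0 1) (- {0}) P M"
    using homotopic_with_trans homotopic_with_symD by blast
  then have "homotopic_with (\<lambda>_. True) (nsphere p) (top_of_set (- {0})) (P \<circ> F) (M \<circ> F)"
    by (rule homotopic_with_compose_continuous_map_right[OF _ contF]) simp
  then have "homotopic_with (\<lambda>_. True) (nsphere p) (top_of_set (sphere 0 1)) (N \<circ> (P \<circ> F)) (N \<circ> (M \<circ> F))"
    by (rule homotopic_with_compose_continuous_map_left[OF _ contN]) simp
  then have h1: "homotopic_with (\<lambda>_. True) (nsphere p) (nsphere p) (K \<circ> (N \<circ> (P \<circ> F))) (K \<circ> (N \<circ> (M \<circ> F)))"
    by (rule homotopic_with_compose_continuous_map_left[OF _ contK]) simp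
  have h2: "homotopic_with (\<lambda>_. True) (nsphere p) (nsphere p) id (K \<circ> (N \<circ> (P \<circ> F)))"
    by (rule homotopic_with_equal) (auto simp: N_def P_def normF KF)
  have h3: "homotopic_with (\<lambda>_. True) (nsphere p) (nsphere p) (\<lambda>x i. - x i) (K \<circ> (N \<circ> (M \<circ> F)))"
  proof (rule homotopic_with_equal)
    show "continuous_map (nsphere p) (nsphere p) (\<lambda>x i. - x i)"
      using continuous_map_nsphere_negate[of p UNIV] by simp
    fix x assume x: "x \<in> topspace (nsphere p)"
    have "K (- F x) = (\<lambda>i. - K (F x) i)"
      by (auto simp: K_def)
    then show "(\<lambda>i. - x i) = (K \<circ> (N \<circ> (M \<circ> F))) x"
      using x by (simp add: N_def M_def normF KF)
  qed simp_all
  have "Brouwer_degree2 p id = Brouwer_degree2 p (K \<circ> (N \<circ> (P \<circ> F)))"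
    by (rule Brouwer_degree2_homotopic[OF h2])
  also have "\<dots> = Brouwer_degree2 p (K \<circ> (N \<circ> (M \<circ> F)))"
    by (rule Brouwer_degree2_homotopic[OF h1])
  also have "\<dots> = Brouwer_degree2 p (\<lambda>x i. - x i)"
    by (rule Brouwer_degree2_homotopic[OF h3, symmetric])
  also have "\<dots> = (-1) ^ DIM('n)"
    unfolding Brouwer_degree2_antipodal p ..
  also have "\<dots> = -1"
    using odd by (rule neg_one_odd_power)
  finally show False
    unfolding Brouwer_degree2_id by simp
qed

section \<open>Differentiability of monotone Lipschitz functions\<close>

text \<open>The Vitali theorem for balls on the line: an interval is coded by its endpoints and read
  as the closed ball around its midpoint. Confinement to \<open>G\<close> costs nothing, since short
  enough intervals containing a point of \<open>G\<close> stay in \<open>G\<close>.\<close>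

lemma Vitali_covering_intervals:
  fixes S :: "real set"
  assumes "open G" "S \<subseteq> G"
    and P: "\<And>t d. t \<in> S \<Longrightarrow> 0 < d \<Longrightarrow> \<exists>a b. a < b \<and> t \<in> {a..b} \<and> b - a < d \<and> P a b"
  obtains C where "countable C" "\<And>a b. (a, b) \<in> C \<Longrightarrow> a < b \<and> {a..b} \<subseteq> G \<and> P a b"
    "disjoint_family_on (\<lambda>(a, b). {a..b}) C" "negligible (S - (\<Union>(a, b)\<in>C. {a..b}))"
proof -
  define K where "K = {(a, b). a < b \<and> {a..b} \<subseteq> G \<and> P a b}"
  define c where "c = (\<lambda>(a, b). (a + b) / 2 :: real)"
  define r where "r = (\<lambda>(a, b). (b - a) / 2 :: real)"
  have cball: "cball (c i) (r i) = (case i of (a, b) \<Rightarrow> {a..b})" for i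
    by (cases i) (auto simp: c_def r_def cball_eq_atLeastAtMost field_simps)
  have 1: "0 < r i" if "i \<in> K" for i
    using that by (auto simp: K_def r_def)
  have 2: "\<exists>i. i \<in> K \<and> t \<in> cball (c i) (r i) \<and> r i < d" if t: "t \<in> S" and d: "0 < d" for t d
  proof -
    obtain e where e: "e > 0" "ball t e \<subseteq> G"
      using openE[OF \<open>open G\<close>, of t] \<open>S \<subseteq> G\<close> \<open>t \<in> S\<close> by blast
    obtain a b where ab: "a < b" "t \<in> {a..b}" "b - a < min d e" "P a b"
      using P[OF t, of "min d e"] d e(1) by auto
    have "{a..b} \<subseteq> ball t e"
      using ab by (auto simp: dist_real_def)
    moreover have "t \<in> cball (c (a, b)) (r (a, b))"
      unfolding cball using ab by simp
    ultimately show ?thesis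
      using ab e d by (intro exI[of _ "(a, b)"]) (auto simp: K_def r_def)
  qed
  obtain C where C: "countable C" "C \<subseteq> K"
     "pairwise (\<lambda>i j. disjnt (cball (c i) (r i)) (cball (c j) (r j))) C"
     "negligible (S - (\<Union>i\<in>C. cball (c i) (r i)))"
    using Vitali_covering_theorem_cballs[of K r S c, OF 1 2] by blast
  show thesis
  proof (rule that)
    show "disjoint_family_on (\<lambda>(a, b). {a..b}) C"
      using C(3) unfolding cball by (auto simp: disjoint_family_on_def pairwise_def disjnt_def)
    show "negligible (S - (\<Union>(a, b)\<in>C. {a..b}))"
      using C(4) unfolding cball .
  qed (use C(1,2) in \<open>auto simp: K_def\<close>)
qed

text \<open>For continuous \<open>F\<close> the Stieltjes measure has no atoms, so a closed interval
  has mass \<open>F b - F a\<close>; countable additivity does the rest. With \<open>F\<close> the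
  identity this is Lebesgue measure.\<close>

lemma emeasure_disjoint_intervals:
  fixes F :: "real \<Rightarrow> real"
  assumes "mono F" "continuous_on UNIV F" "countable C"
    and C: "\<And>a b. (a, b) \<in> C \<Longrightarrow> a < b" "disjoint_family_on (\<lambda>(a, b). {a..b}) C"
  shows "emeasure (interval_measure F) (\<Union>(a, b)\<in>C. {a..b}) =
    (\<integral>\<^sup>+(a, b). ennreal (F b - F a) \<partial>count_space C)"
proof -
  have "emeasure (interval_measure F) (\<Union>(a, b)\<in>C. {a..b}) =
    (\<integral>\<^sup>+i. emeasure (interval_measure F) (case i of (a, b) \<Rightarrow> {a..b}) \<partial>count_space C)"
    using assms by (intro emeasure_UN_countable) auto
  also have "\<dots> = (\<integral>\<^sup>+(a, b). ennreal (F b - F a) \<partial>count_space C)"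
    using assms by (intro nn_integral_cong)
      (auto intro!: emeasure_interval_measure_Icc simp: monoD less_imp_le)
  finally show ?thesis .
qed

text \<open>
  Two successive Vitali coverings: intervals of slope at most \<open>p\<close> cover the exceptional set almost
  tightly, and inside these, intervals of slope at least \<open>q\<close> cover it again. Comparing the
  increments of \<open>F\<close> gives \<open>q m \<le> p m\<close> for the outer measure \<open>m\<close> of the set.
\<close>
lemma negligible_derived_number_gap:
  fixes F :: "real \<Rightarrow> real"
  assumes F: "mono F" "continuous_on UNIV F" and "p < q"
  shows "negligible {t. (\<exists>\<^sub>F s in at t. (F s - F t) / (s - t) < p) \<and> (\<exists>\<^sub>F s in at t. q < (F s - F t) / (s - t))}"
    (is "negligible ?E")
proof (subst negligible_on_intervals, intro allI)
  fix x y
  define E where "E = ?E \<inter> cbox x y"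
  let ?mu = "interval_measure F"
  let ?leb = "interval_measure (\<lambda>x. x)"
  \<comment> \<open>The quotient at \<open>t\<close> is the slope of \<open>F\<close> over the
    interval between \<open>s\<close> and \<open>t\<close>, in either order, so a frequent property
    of quotients yields arbitrarily short intervals with endpoint \<open>t\<close>.\<close>
  have near: "\<exists>a b. a < b \<and> t \<in> {a..b} \<and> b - a < d \<and> R ((F b - F a) / (b - a))"
    if R: "\<exists>\<^sub>F s in at t. R ((F s - F t) / (s - t))" and "0 < d" for R t d
  proof -
    have "\<forall>\<^sub>F s in at t. s \<noteq> t \<and> dist s t < d"
      using \<open>0 < d\<close> by (auto simp: eventually_at intro!: exI[of _ d])
    with R have "\<exists>\<^sub>F s in at t. (s \<noteq> t \<and> dist s t < d) \<and> R ((F s - F t) / (s - t))"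
      by (rule frequently_eventually_conj)
    then obtain s where s: "R ((F s - F t) / (s - t))" "s \<noteq> t" "dist s t < d"
      using frequently_ex by blast
    show ?thesis
    proof (cases "s < t")
      case True
      have "(F s - F t) / (s - t) = (F t - F s) / (t - s)"
        by (metis minus_diff_eq minus_divide_divide)
      with True s show ?thesis
        by (intro exI[of _ s] exI[of _ t]) (auto simp: dist_real_def)
    next
      case False
      with s show ?thesis
        by (intro exI[of _ t] exI[of _ s]) (auto simp: dist_real_def)
    qed
  qed
  have low: "\<exists>a b. a < b \<and> t \<in> {a..b} \<and> b - a < d \<and> F b - F a \<le> p * (b - a)" if "t \<in> E" "0 < d" for t d
    using near[of "\<lambda>r. r < p" t d] that by (fastforce simp: E_def field_simps)
  have high: "\<exists>a b. a < b \<and> t \<in> {a..b} \<and> b - a < d \<and> q * (b - a) \<le> F b - F a" if "t \<in> E" "0 < d" for t d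
    using near[of "\<lambda>r. q < r" t d] that by (fastforce simp: E_def field_simps)
  have "negligible E"
  \<comment> \<open>Difference quotients of a monotone function are nonnegative, so for
    \<open>p \<le> 0\<close> the set is empty.\<close>
  proof (cases "p > 0")
    case False
    have "E = {}"
    proof (rule ccontr)
      assume "E \<noteq> {}"
      then obtain t where "t \<in> E" by blast
      then have "\<exists>\<^sub>F s in at t. (F s - F t) / (s - t) < p"
        by (auto simp: E_def)
      then obtain s where s: "(F s - F t) / (s - t) < p"
        using frequently_ex by blast
      have "0 \<le> (F s - F t) / (s - t)"
        using \<open>mono F\<close> by (cases s t rule: linorder_cases)
          (auto simp: monoD less_imp_le intro: divide_nonpos_nonpos divide_nonneg_nonneg)
      with s False show False by linarith
    qed
    then show ?thesis by simp
  next
    case True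
    \<comment> \<open>The argument runs with the outer measure \<open>m\<close> of \<open>E\<close>;
      the measurable hull \<open>H\<close> supplies open supersets of measure at most
      \<open>m + e\<close>.\<close>
    obtain H where H: "H \<in> sets lebesgue" "E \<subseteq> H" "outer_measure_of lebesgue E = emeasure lebesgue H"
      using outer_measure_of_attain[of E lebesgue] by auto
    define m where "m = outer_measure_of lebesgue E"
    have "m \<le> emeasure lebesgue (cbox x y)"
      unfolding m_def using outer_measure_of_mono[of E "cbox x y" lebesgue] by (simp add: E_def)
    also have "\<dots> < \<infinity>"
      using emeasure_lborel_cbox_finite[of x y] by simp
    finally have "m < \<infinity>" .
    have key: "q * m \<le> p * (m + ennreal e)" if "e > 0" for e :: real
    proof -
      obtain T where T: "open T" "H \<subseteq> T" "T - H \<in> lmeasurable" "emeasure lebesgue (T - H) < ennreal e"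
        using sets_lebesgue_outer_open[OF H(1) \<open>e > 0\<close>] by blast
      have "emeasure lebesgue T \<le> emeasure lebesgue H + emeasure lebesgue (T - H)"
        using T H emeasure_subadditive[of H lebesgue "T - H"] by (simp add: Un_absorb1)
      also have "\<dots> \<le> m + ennreal e"
        unfolding m_def H(3) using T(4) by (intro add_left_mono) auto
      finally have T': "emeasure lborel T \<le> m + ennreal e"
        using T(1) by simp
      obtain C1 where C1: "countable C1"
        "\<And>a b. (a, b) \<in> C1 \<Longrightarrow> a < b \<and> {a..b} \<subseteq> T \<and> F b - F a \<le> p * (b - a)"
        "disjoint_family_on (\<lambda>(a, b). {a..b}) C1" "negligible (E - (\<Union>(a, b)\<in>C1. {a..b}))"
        using Vitali_covering_intervals[of T E "\<lambda>a b. F b - F a \<le> p * (b - a)", OF _ _ low] T H by blast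
      \<comment> \<open>Taking open interiors allows the second covering to be placed inside the
        first; only the countably many endpoints are lost.\<close>
      define G where "G = (\<Union>(a, b)\<in>C1. {a<..<b})"
      have "open G" by (auto simp: G_def)
      obtain C2 where C2: "countable C2"
        "\<And>a b. (a, b) \<in> C2 \<Longrightarrow> a < b \<and> {a..b} \<subseteq> G \<and> q * (b - a) \<le> F b - F a"
        "disjoint_family_on (\<lambda>(a, b). {a..b}) C2" "negligible (E \<inter> G - (\<Union>(a, b)\<in>C2. {a..b}))"
        using Vitali_covering_intervals[of G "E \<inter> G" "\<lambda>a b. q * (b - a) \<le> F b - F a", OF \<open>open G\<close> _ high] by blast
      define V1 where "V1 = (\<Union>(a, b)\<in>C1. {a..b})"
      define V2 where "V2 = (\<Union>(a, b)\<in>C2. {a..b})"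
      have V: "V1 \<in> sets borel" "V2 \<in> sets borel"
        unfolding V1_def V2_def using C1(1) C2(1) by (auto intro!: sets.countable_UN')
      have "V1 \<subseteq> T" using C1(2) by (auto simp: V1_def simp del: atLeastAtMost_iff)
      have "G \<subseteq> V1" unfolding V1_def G_def by (rule UN_mono) auto
      have "V2 \<subseteq> G" using C2(2) by (auto simp: V2_def simp del: atLeastAtMost_iff)
      have "negligible (fst ` C1 \<union> snd ` C1)"
        using C1(1) by (simp add: negligible_iff_null_sets null_sets_completionI countable_imp_null_set_lborel)
      have "negligible (E - V2)"
      proof (rule negligible_subset)
        show "negligible ((E - V1) \<union> (fst ` C1 \<union> snd ` C1) \<union> (E \<inter> G - V2))"
          using C1(4) C2(4) \<open>negligible (fst ` C1 \<union> snd ` C1)\<close> unfolding V1_def V2_def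
          by (simp only: negligible_Un_eq)
        show "E - V2 \<subseteq> (E - V1) \<union> (fst ` C1 \<union> snd ` C1) \<union> (E \<inter> G - V2)"
        proof
          fix t assume t: "t \<in> E - V2"
          show "t \<in> (E - V1) \<union> (fst ` C1 \<union> snd ` C1) \<union> (E \<inter> G - V2)"
          proof (cases "t \<in> V1")
            case True
            then obtain a b where ab: "(a, b) \<in> C1" "a \<le> t" "t \<le> b"
              by (auto simp: V1_def)
            then consider "t = a" | "t = b" | "t \<in> {a<..<b}"
              by fastforce
            then show ?thesis
            proof cases
              case 3
              then have "t \<in> G"
                unfolding G_def using ab(1) by (intro UN_I[of "(a, b)"]) auto
              then show ?thesis using t by simp
            qed (use ab(1) in force)+
          qed (use t in auto)
        qed
      qed
      then have null: "E - V2 \<in> null_sets lebesgue"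
        by (simp add: negligible_iff_null_sets)
      \<comment> \<open>With \<open>mu\<close> the Stieltjes measure and bars for Lebesgue measure,
        the chain is \<open>q m \<le> q |V2| \<le> mu V2 \<le> mu V1 \<le> p |V1| \<le> p (m +
        e)\<close>.\<close>
      have "m \<le> outer_measure_of lebesgue (V2 \<union> (E - V2))"
        unfolding m_def by (rule outer_measure_of_mono) auto
      also have "\<dots> = emeasure lebesgue (V2 \<union> (E - V2))"
      proof (rule outer_measure_of_eq, rule sets.Un)
        show "V2 \<in> sets lebesgue" "E - V2 \<in> sets lebesgue"
          using V null by auto
      qed
      also have "\<dots> = emeasure lebesgue V2"
        using V null by (intro emeasure_Un_null_set) auto
      also have "\<dots> = emeasure ?leb V2"
        using V by (simp add: lborel_eq_real)
      finally have "ennreal q * m \<le> ennreal q * emeasure ?leb V2"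
        by (rule mult_left_mono) simp
      also have "\<dots> = (\<integral>\<^sup>+i. ennreal q * (case i of (a, b) \<Rightarrow> ennreal (b - a)) \<partial>count_space C2)"
        unfolding V2_def using C2
        by (subst emeasure_disjoint_intervals) (auto simp: nn_integral_cmult monoI)
      also have "\<dots> \<le> (\<integral>\<^sup>+(a, b). ennreal (F b - F a) \<partial>count_space C2)"
        using C2(2) \<open>p < q\<close> True
        by (intro nn_integral_mono) (force simp: ennreal_mult'[symmetric] intro!: ennreal_leI)
      also have "\<dots> = emeasure ?mu V2"
        unfolding V2_def using C2 F by (subst emeasure_disjoint_intervals) auto
      also have "\<dots> \<le> emeasure ?mu V1"
        using V \<open>V2 \<subseteq> G\<close> \<open>G \<subseteq> V1\<close> by (intro emeasure_mono) auto
      also have "\<dots> = (\<integral>\<^sup>+(a, b). ennreal (F b - F a) \<partial>count_space C1)"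
        unfolding V1_def using C1 F by (subst emeasure_disjoint_intervals) auto
      also have "\<dots> \<le> (\<integral>\<^sup>+i. ennreal p * (case i of (a, b) \<Rightarrow> ennreal (b - a)) \<partial>count_space C1)"
        using C1(2) True
        by (intro nn_integral_mono) (force simp: ennreal_mult'[symmetric] intro!: ennreal_leI)
      also have "\<dots> = ennreal p * emeasure ?leb V1"
        unfolding V1_def using C1
        by (subst emeasure_disjoint_intervals) (auto simp: nn_integral_cmult monoI)
      also have "\<dots> \<le> ennreal p * emeasure lborel T"
        using V T \<open>V1 \<subseteq> T\<close> unfolding lborel_eq_real by (intro mult_left_mono emeasure_mono) auto
      also have "\<dots> \<le> ennreal p * (m + ennreal e)"
        by (intro mult_left_mono T') simp
      finally show ?thesis .
    qed
    define M where "M = enn2real m"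
    have M: "m = ennreal M" "M \<ge> 0"
      using \<open>m < \<infinity>\<close> by (auto simp: M_def less_top)
    have "q * M \<le> p * (M + e)" if "e > 0" for e
      using key[OF that] that M True \<open>p < q\<close> by (simp add: ennreal_mult'[symmetric] ennreal_plus[symmetric] del: ennreal_plus)
    then have "q * M \<le> p * M + e" if "e > 0" for e
      using that True by (metis distrib_left divide_pos_pos less_irrefl nonzero_mult_div_cancel_left times_divide_eq_right)
    then have "q * M \<le> p * M"
      by (rule field_le_epsilon)
    then have "M = 0"
      using \<open>p < q\<close> M by (metis mult_less_cancel_right not_less order_le_less)
    then have "emeasure lebesgue H = 0"
      using M H m_def by simp
    then show ?thesis
      using H negligible_iff_emeasure0 negligible_subset by blast
  qed
  then show "negligible (?E \<inter> cbox x y)"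
    by (simp add: E_def)
qed

text \<open>Where the derivative fails to exist, the lower and upper limits of the quotients, both
  finite by the Lipschitz bound, are separated by rationals \<open>p < q\<close>. Such points lie in
  a countable union of null sets.\<close>

theorem lipschitz_mono_differentiable_ae:
  fixes F :: "real \<Rightarrow> real"
  assumes "mono F" and lip: "L-lipschitz_on UNIV F"
  shows "negligible {t. \<not> F differentiable (at t)}"
proof -
  define Q where "Q = (\<lambda>t s. (F s - F t) / (s - t))"
  define E where "E = (\<lambda>p q. {t. (\<exists>\<^sub>F s in at t. Q t s < p) \<and> (\<exists>\<^sub>F s in at t. q < Q t s)})"
  have Q0: "0 \<le> Q t s" for t s
    using \<open>mono F\<close> unfolding Q_def by (cases s t rule: linorder_cases)
      (auto simp: monoD less_imp_le intro: divide_nonpos_nonpos divide_nonneg_nonneg)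
  have QL: "Q t s \<le> L" for t s
  proof -
    have "\<bar>F s - F t\<bar> \<le> L * \<bar>s - t\<bar>"
      using lipschitz_onD[OF lip, of s t] by (simp add: dist_real_def)
    then have abs: "\<bar>Q t s\<bar> \<le> L" if "s \<noteq> t"
      using that by (simp add: Q_def abs_divide field_simps)
    show ?thesis
    proof (cases "s = t")
      case True
      then show ?thesis using lipschitz_on_nonneg[OF lip] by (simp add: Q_def)
    next
      case False
      then show ?thesis using abs by (blast dest: abs_le_D1)
    qed
  qed
  have diff: "F differentiable (at t)" if t: "\<And>p q. p \<in> \<rat> \<Longrightarrow> q \<in> \<rat> \<Longrightarrow> p < q \<Longrightarrow> t \<notin> E p q" for t
  proof -
    \<comment> \<open>\<open>Sup A\<close> is the lower limit of the quotients at \<open>t\<close>,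
      the candidate for the derivative.\<close>
    define A where "A = {p. \<forall>\<^sub>F s in at t. p \<le> Q t s}"
    have bdd: "bdd_above A"
    proof (rule bdd_aboveI)
      fix p assume "p \<in> A"
      then have "\<forall>\<^sub>F s in at t. p \<le> Q t s" by (simp add: A_def)
      then obtain s where "p \<le> Q t s"
        using eventually_happens'[OF at_neq_bot] by blast
      then show "p \<le> L" using QL by (meson order_trans)
    qed
    have "0 \<in> A" using Q0 by (simp add: A_def)
    have "(Q t \<longlongrightarrow> Sup A) (at t)"
    proof (rule order_tendstoI)
      fix a assume "a < Sup A"
      then obtain p where "p \<in> A" "a < p"
        using less_cSup_iff[OF _ bdd] \<open>0 \<in> A\<close> by blast
      then show "\<forall>\<^sub>F s in at t. a < Q t s"
        by (auto simp: A_def elim: eventually_mono)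
    next
      fix a assume "Sup A < a"
      then obtain q where q: "q \<in> \<rat>" "Sup A < q" "q < a"
        using Rats_dense_in_real by blast
      then obtain p where p: "p \<in> \<rat>" "Sup A < p" "p < q"
        using Rats_dense_in_real by blast
      \<comment> \<open>Quotients fall below \<open>p\<close> frequently because \<open>p\<close>
        exceeds the lower limit. Since \<open>t\<close> is outside \<open>E p q\<close>, they cannot
        also exceed \<open>q\<close> frequently, so eventually they are at most
        \<open>q < a\<close>.\<close>
      have "p \<notin> A"
        using cSup_upper[OF _ bdd] p by force
      then have "\<exists>\<^sub>F s in at t. Q t s < p"
        by (simp add: A_def not_eventually not_le)
      then have "\<not> (\<exists>\<^sub>F s in at t. q < Q t s)"
        using t[of p q] p q by (auto simp: E_def)
      then show "\<forall>\<^sub>F s in at t. Q t s < a"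
        using q unfolding not_frequently by (auto elim!: eventually_mono)
    qed
    then show ?thesis
      using has_field_derivative_iff real_differentiable_def unfolding Q_def by blast
  qed
  have "continuous_on UNIV F"
    using lip by (rule lipschitz_on_continuous_on)
  then have E: "E p q \<in> null_sets lebesgue" if "p < q" for p q
    using negligible_derived_number_gap[OF \<open>mono F\<close> _ that]
    by (simp add: E_def Q_def negligible_iff_null_sets)
  have "(\<Union>(p, q)\<in>{(p, q). p \<in> \<rat> \<and> q \<in> \<rat> \<and> p < q}. E p q) \<in> null_sets lebesgue"
  proof (rule null_sets_UN')
    have "countable (\<rat> \<times> \<rat> :: (real \<times> real) set)"
      by (intro countable_SIGMA countable_rat)
    then show "countable {(p::real, q::real). p \<in> \<rat> \<and> q \<in> \<rat> \<and> p < q}"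
      by (rule countable_subset[rotated]) auto
  qed (use E in auto)
  then have "negligible (\<Union>(p, q)\<in>{(p, q). p \<in> \<rat> \<and> q \<in> \<rat> \<and> p < q}. E p q)"
    by (simp add: negligible_iff_null_sets)
  then show ?thesis
    by (rule negligible_subset) (use diff in blast)
qed

section \<open>The fundamental theorem of calculus for absolutely continuous functions\<close>

lemma abs_continuous_on_subset:
  "abs_continuous_on S f \<Longrightarrow> T \<subseteq> S \<Longrightarrow> abs_continuous_on T f"
  unfolding abs_continuous_on_def by (meson order_trans)

text \<open>Henstock-Kurzweil sums are split by tag. Outside \<open>E\<close>, differentiability at
  the tag controls each piece; at tags in \<open>E\<close>, the gauge forces the pieces into an open
  set of small measure, where absolute continuity makes the increments of \<open>f\<close>
  small.\<close>

theorem fundamental_theorem_of_calculus_abs_continuous: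
  fixes f :: "real \<Rightarrow> 'a::banach"
  assumes "a \<le> b" and ac: "abs_continuous_on {a..b} f" and "negligible E"
    and deriv: "\<And>t. t \<in> {a..b} - E \<Longrightarrow> (f has_vector_derivative f' t) (at t within {a..b})"
  shows "(f' has_integral (f b - f a)) {a..b}"
proof (rule has_integral_spike[OF \<open>negligible E\<close>])
  \<comment> \<open>Setting the integrand to 0 on \<open>E\<close> leaves only the increments of
    \<open>f\<close> for pieces tagged in \<open>E\<close>.\<close>
  let ?g = "\<lambda>t. if t \<in> E then 0 else f' t"
  show "(?g has_integral (f b - f a)) {a..b}"
    unfolding has_integral_real
  proof (intro allI impI)
    fix e :: real assume "e > 0"
    define e' where "e' = e / (2 * (b - a + 1))"
    have "e' > 0" using \<open>e > 0\<close> \<open>a \<le> b\<close> by (simp add: e'_def)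
    have "e' * (b - a) < e / 2"
      using \<open>e > 0\<close> \<open>a \<le> b\<close> by (simp add: e'_def field_simps)
    have "\<forall>t. \<exists>d>0. t \<in> {a..b} - E \<longrightarrow>
         (\<forall>y\<in>{a..b}. norm (y - t) < d \<longrightarrow> norm (f y - f t - (y - t) *\<^sub>R f' t) \<le> e' * norm (y - t))"
      using deriv \<open>e' > 0\<close> unfolding has_vector_derivative_def has_derivative_within_alt by (meson zero_less_one)
    then obtain d where d: "\<And>t. 0 < d t"
       "\<And>t y. t \<in> {a..b} - E \<Longrightarrow> y \<in> {a..b} \<Longrightarrow> norm (y - t) < d t \<Longrightarrow>
          norm (f y - f t - (y - t) *\<^sub>R f' t) \<le> e' * norm (y - t)"
      by metis
    from spec[OF ac[unfolded abs_continuous_on_def], of "e / 2"] \<open>e > 0\<close>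
    obtain \<delta> where \<delta>: "\<delta> > 0" and ac': "\<forall>(n::nat) u v. (\<forall>k<n. u k \<le> v k \<and> {u k..v k} \<subseteq> {a..b}) \<and>
        disjoint_family_on (\<lambda>k. {u k<..<v k}) {..<n} \<and> (\<Sum>k<n. v k - u k) < \<delta> \<longrightarrow>
        (\<Sum>k<n. norm (f (v k) - f (u k))) < e / 2"
      by (elim impE exE conjE) simp
    \<comment> \<open>\<open>T\<close> exceeds the null set \<open>E\<close> by less than
      \<open>\<delta>\<close>, so \<open>T\<close> itself has measure below
      \<open>\<delta>\<close>.\<close>
    obtain T where T: "open T" "E \<subseteq> T" "emeasure lebesgue (T - E) < ennreal \<delta>"
      using sets_lebesgue_outer_open[OF negligible_imp_sets[OF \<open>negligible E\<close>] \<delta>] by metis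
    have ET: "E \<in> null_sets lebesgue"
      using \<open>negligible E\<close> by (simp add: negligible_iff_null_sets)
    have T\<delta>: "emeasure lborel T < ennreal \<delta>"
    proof -
      have "emeasure lborel T = emeasure lebesgue T"
        using T(1) by simp
      also have "\<dots> = emeasure lebesgue (T - E)"
        using T(1) ET by (simp add: emeasure_Diff_null_set)
      finally show ?thesis using T(3) by simp
    qed
    define \<gamma> where "\<gamma> = (\<lambda>t. if t \<in> E then T else ball t (d t))"
    show "\<exists>\<gamma>. gauge \<gamma> \<and> (\<forall>p. p tagged_division_of {a..b} \<and> \<gamma> fine p \<longrightarrow>
        norm ((\<Sum>(x, K)\<in>p. measure lborel K *\<^sub>R ?g x) - (f b - f a)) < e)"
    proof (intro exI[of _ \<gamma>] conjI allI impI)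
      show "gauge \<gamma>"
        using T d(1) by (auto simp: \<gamma>_def gauge_def)
      fix p assume "p tagged_division_of {a..b} \<and> \<gamma> fine p"
      then have p: "p tagged_division_of {a..b}" and fine: "\<gamma> fine p" by auto
      have "finite p" using p by blast
      have K: "\<exists>u v. K = {u..v} \<and> u \<le> v \<and> x \<in> {u..v} \<and> {u..v} \<subseteq> {a..b} \<and> {u..v} \<subseteq> \<gamma> x" if "(x, K) \<in> p" for x K
        using tagged_division_ofD(2,3,4)[OF p that] fineD[OF fine that] by fastforce
      define pE where "pE = {(x, K) \<in> p. x \<in> E}"
      define pN where "pN = {(x, K) \<in> p. x \<notin> E}"
      have split: "p = pE \<union> pN" "pE \<inter> pN = {}" "finite pE" "finite pN"
        using \<open>finite p\<close> by (auto simp: pE_def pN_def intro: rev_finite_subset)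
      let ?h = "\<lambda>(x, K). measure lborel K *\<^sub>R ?g x - (f (Sup K) - f (Inf K))"
      have "(\<Sum>(x, K)\<in>p. measure lborel K *\<^sub>R ?g x) - (f b - f a) = (\<Sum>i\<in>p. ?h i)"
        using additive_tagged_division_1[OF \<open>a \<le> b\<close> p, of f] by (simp add: split_def sum_subtractf)
      also have "\<dots> = (\<Sum>i\<in>pE. ?h i) + (\<Sum>i\<in>pN. ?h i)"
        unfolding split(1) using split by (intro sum.union_disjoint) auto
      finally have "norm ((\<Sum>(x, K)\<in>p. measure lborel K *\<^sub>R ?g x) - (f b - f a)) \<le> norm (\<Sum>i\<in>pE. ?h i) + norm (\<Sum>i\<in>pN. ?h i)"
        by (simp add: norm_triangle_ineq)
      moreover have "norm (\<Sum>i\<in>pN. ?h i) < e / 2"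
      proof -
        have "norm (?h i) \<le> e' * (case i of (x, K) \<Rightarrow> measure lborel K)" if iN: "i \<in> pN" for i
        proof -
          obtain x K' where i: "i = (x, K')" "(x, K') \<in> p" "x \<notin> E"
            using iN by (auto simp: pN_def)
          then obtain u v where uv: "K' = {u..v}" "u \<le> x" "x \<le> v" "{u..v} \<subseteq> {a..b}" "{u..v} \<subseteq> ball x (d x)"
            using K[OF i(2)] by (auto simp: \<gamma>_def)
          have x: "x \<in> {a..b} - E" "u \<in> {a..b}" "v \<in> {a..b}" "norm (u - x) < d x" "norm (v - x) < d x"
            using uv(2,3) i(3) subsetD[OF uv(4)] subsetD[OF uv(5), of u] subsetD[OF uv(5), of v]
            by (auto simp: dist_norm norm_minus_commute)
          have "norm (f v - f x - (v - x) *\<^sub>R f' x) \<le> e' * (v - x)"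
            using d(2)[OF x(1,3,5)] uv by simp
          moreover have "norm (f u - f x - (u - x) *\<^sub>R f' x) \<le> e' * (x - u)"
            using d(2)[OF x(1,2,4)] uv by (simp add: abs_minus_commute)
          \<comment> \<open>Straddling: the increment over the piece is split at its tag
            \<open>x\<close>, and the linear approximation at \<open>x\<close> is applied towards
            each endpoint.\<close>
          moreover have "?h i = (f u - f x - (u - x) *\<^sub>R f' x) - (f v - f x - (v - x) *\<^sub>R f' x)"
            using i uv by (simp add: algebra_simps)
          ultimately show ?thesis
            using i uv norm_triangle_ineq4[of "f u - f x - (u - x) *\<^sub>R f' x" "f v - f x - (v - x) *\<^sub>R f' x"]
            by (simp add: algebra_simps)
        qed
        then have "norm (\<Sum>i\<in>pN. ?h i) \<le> (\<Sum>i\<in>pN. e' * (case i of (x, K) \<Rightarrow> measure lborel K))"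
          by (intro sum_norm_le)
        also have "\<dots> \<le> (\<Sum>i\<in>p. e' * (case i of (x, K) \<Rightarrow> measure lborel K))"
          using split \<open>finite p\<close> \<open>e' > 0\<close> by (intro sum_mono2) auto
        also have "\<dots> = e' * (b - a)"
          using additive_content_tagged_division[of p a b] p \<open>a \<le> b\<close> by (simp flip: sum_distrib_left)
        finally show ?thesis
          using \<open>e' * (b - a) < e / 2\<close> by linarith
      qed
      moreover have "norm (\<Sum>i\<in>pE. ?h i) < e / 2"
      proof -
        \<comment> \<open>The pieces tagged in \<open>E\<close> are enumerated by an initial segment
          of the naturals, the form in which \<open>abs_continuous_on\<close> takes its
          intervals.\<close>
        obtain h where h: "bij_betw h {..<card pE} pE"
          using ex_bij_betw_nat_finite[OF split(3)] by (auto simp: lessThan_atLeast0)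
        define u where "u = (\<lambda>k. Inf (snd (h k)))"
        define v where "v = (\<lambda>k. Sup (snd (h k)))"
        have hk: "\<exists>x. h k = (x, {u k..v k}) \<and> h k \<in> p \<and> x \<in> E \<and> u k \<le> v k \<and> {u k..v k} \<subseteq> {a..b} \<and> {u k..v k} \<subseteq> T"
          if "k < card pE" for k
        proof -
          have "h k \<in> pE" using h that by (auto simp: bij_betw_def)
          then obtain x K' where i: "h k = (x, K')" "(x, K') \<in> p" "x \<in> E"
            by (auto simp: pE_def)
          then show ?thesis
            using K[OF i(2)] by (auto simp: \<gamma>_def u_def v_def)
        qed
        then have le: "u k \<le> v k" if "k < card pE" for k
          using that by blast
        have disj: "disjoint_family_on (\<lambda>k. {u k<..<v k}) {..<card pE}"
        proof (unfold disjoint_family_on_def, intro ballI impI)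
          fix j k assume jk: "j \<in> {..<card pE}" "k \<in> {..<card pE}" "j \<noteq> k"
          then have "h j \<noteq> h k"
            using bij_betw_imp_inj_on[OF h] by (auto simp: inj_on_def)
          moreover obtain x y where "h j = (x, {u j..v j})" "h k = (y, {u k..v k})" "h j \<in> p" "h k \<in> p"
            using hk jk by (metis lessThan_iff)
          ultimately have "interior {u j..v j} \<inter> interior {u k..v k} = {}"
            using tagged_division_ofD(5)[OF p] by metis
          then show "{u j<..<v j} \<inter> {u k<..<v k} = {}"
            by (simp add: interior_atLeastAtMost_real)
        qed
        have "ennreal (\<Sum>k<card pE. v k - u k) = (\<Sum>k<card pE. emeasure lborel {u k<..<v k})"
          using hk by (subst sum_ennreal[symmetric]) (force intro!: sum.cong)+
        also have "\<dots> = emeasure lborel (\<Union>k<card pE. {u k<..<v k})"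
          using disj by (intro sum_emeasure) auto
        also have "\<dots> \<le> emeasure lborel T"
          using T(1) hk by (intro emeasure_mono) (force simp: subset_iff)+
        also have "\<dots> < ennreal \<delta>" by (rule T\<delta>)
        finally have "(\<Sum>k<card pE. v k - u k) < \<delta>"
          using le by (subst (asm) ennreal_less_iff) (auto intro!: sum_nonneg)
        then have *: "(\<Sum>k<card pE. norm (f (v k) - f (u k))) < e / 2"
          using hk disj by (intro ac'[rule_format]) blast
        have "norm (\<Sum>i\<in>pE. ?h i) \<le> (\<Sum>i\<in>pE. norm (f (Sup (snd i)) - f (Inf (snd i))))"
          by (intro sum_norm_le) (auto simp: pE_def norm_minus_commute)
        also have "\<dots> = (\<Sum>k<card pE. norm (f (v k) - f (u k)))"
          unfolding u_def v_def by (rule sum.reindex_bij_betw[OF h, symmetric])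
        finally show ?thesis using * by linarith
      qed
      ultimately show "norm ((\<Sum>(x, K)\<in>p. measure lborel K *\<^sub>R ?g x) - (f b - f a)) < e"
        by linarith
    qed
  qed
qed auto

section \<open>Trajectories and integrated controls\<close>

text \<open>The weights are arbitrary real vectors because increments \<open>U t - U s\<close> of
  either sign are inserted, not only convex weights.\<close>

definition mixed_field :: "('i::finite \<Rightarrow> real^'d^'d) \<Rightarrow> real^'i \<Rightarrow> real^'d \<Rightarrow> real^'d" where
  "mixed_field A w v = (\<Sum>i\<in>UNIV. (w $ i) *\<^sub>R (A i *v v))"

definition field_bound :: "('i::finite \<Rightarrow> real^'d^'d) \<Rightarrow> real" where
  "field_bound A = (\<Sum>i\<in>UNIV. onorm ((*v) (A i)))"

lemma field_bound_nonneg: "0 \<le> field_bound A"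
  unfolding field_bound_def by (intro sum_nonneg onorm_pos_le) simp

lemma mixed_field_diff: "mixed_field A w (v - v') = mixed_field A w v - mixed_field A w v'"
  by (simp add: mixed_field_def matrix_vector_mult_diff_distrib scaleR_diff_right sum_subtractf)

lemma mixed_field_minus: "mixed_field A (- w) v = - mixed_field A w v"
  by (simp add: mixed_field_def sum_negf)

lemma mixed_field_scale: "mixed_field A (c *\<^sub>R w) v = c *\<^sub>R mixed_field A w v"
  by (simp add: mixed_field_def scaleR_sum_right)

lemma continuous_mixed_field: "continuous_on S (\<lambda>z. mixed_field A (fst z) (snd z))"
  unfolding mixed_field_def
  by (intro continuous_intros linear_continuous_on_compose[OF continuous_on_snd[OF continuous_on_id]]) simp_all

lemma norm_mixed_field_le:
  assumes "\<And>i. \<bar>w $ i\<bar> \<le> b"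
  shows "norm (mixed_field A w v) \<le> b * field_bound A * norm v"
proof -
  have "norm (mixed_field A w v) \<le> (\<Sum>i\<in>UNIV. b * (onorm ((*v) (A i)) * norm v))"
    unfolding mixed_field_def
  proof (rule sum_norm_le)
    fix i
    have "norm (A i *v v) \<le> onorm ((*v) (A i)) * norm v"
      by (rule onorm) simp
    then show "norm (w $ i *\<^sub>R (A i *v v)) \<le> b * (onorm ((*v) (A i)) * norm v)"
      using assms[of i] by (auto intro!: mult_mono)
  qed
  also have "\<dots> = b * field_bound A * norm v"
    by (simp add: field_bound_def sum_distrib_left sum_distrib_right mult.assoc)
  finally show ?thesis .
qed

text \<open>Here \<open>U\<close> stands for the integral of the control. All conditions are closed under
  pointwise convergence, unlike the differential formulation in \<^const>\<open>trajectory\<close>.\<close>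
definition integrated_control ::
  "('i::finite \<Rightarrow> real^'d^'d) \<Rightarrow> real \<Rightarrow> real \<Rightarrow> (real \<Rightarrow> real^'d) \<Rightarrow> (real \<Rightarrow> real^'i) \<Rightarrow> bool" where
  "integrated_control A L C x U \<longleftrightarrow> (\<forall>s\<ge>0. \<forall>t\<ge>0.
     norm (x t - x s) \<le> L * \<bar>t - s\<bar> \<and>
     norm (x t - x s - mixed_field A (U t - U s) (x s)) \<le> C * (t - s)\<^sup>2 \<and>
     (s \<le> t \<longrightarrow> (\<forall>i. U s $ i \<le> U t $ i)) \<and> (\<Sum>i\<in>UNIV. U t $ i - U s $ i) = t - s)"

lemma integrated_controlD:
  assumes "integrated_control A L C x U" "0 \<le> s" "0 \<le> t"
  shows "norm (x t - x s) \<le> L * \<bar>t - s\<bar>"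
    "norm (x t - x s - mixed_field A (U t - U s) (x s)) \<le> C * (t - s)\<^sup>2"
    "s \<le> t \<Longrightarrow> U s $ i \<le> U t $ i" "(\<Sum>i\<in>UNIV. U t $ i - U s $ i) = t - s"
  using assms unfolding integrated_control_def by blast+

text \<open>For \<open>s \<le> t\<close> the component increments are nonnegative and add up to
  \<open>t - s\<close>, so none exceeds it.\<close>

lemma integrated_control_component_bound:
  assumes "integrated_control A L C x U" "0 \<le> s" "0 \<le> t"
  shows "\<bar>U t $ i - U s $ i\<bar> \<le> \<bar>t - s\<bar>"
proof -
  have *: "U t $ i - U s $ i \<le> t - s" if "0 \<le> s" "s \<le> t" for s t
  proof -
    have "U t $ i - U s $ i \<le> (\<Sum>i\<in>UNIV. U t $ i - U s $ i)"
      using integrated_controlD(3)[OF assms(1)] that by (intro member_le_sum) auto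
    then show ?thesis
      using integrated_controlD(4)[OF assms(1), of s t] that by simp
  qed
  show ?thesis
    using *[of s t] *[of t s] integrated_controlD(3)[OF assms(1), of s t i]
      integrated_controlD(3)[OF assms(1), of t s i] assms(2,3)
    by (cases "s \<le> t") auto
qed

lemma AE_lebesgue_on_nonneg_negligible:
  assumes "AE t in lebesgue_on {0::real..}. P t"
  shows "negligible {t. 0 \<le> t \<and> \<not> P t}"
proof -
  have "AE t in lebesgue. t \<in> {0..} \<longrightarrow> P t"
    using assms by (subst (asm) AE_restrict_space_iff) auto
  then obtain N where N: "negligible N" "{t. \<not> (t \<in> {0..} \<longrightarrow> P t)} \<subseteq> N"
    unfolding eventually_ae_filter_negligible by blast
  then show ?thesis
    using negligible_subset[OF N(1), of "{t. 0 \<le> t \<and> \<not> P t}"] by auto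
qed

text \<open>\<open>U\<close> is the integral of the control. The bound \<open>c\<close> on the state
  makes the velocity at most \<open>field_bound A * c\<close>, which is the Lipschitz constant;
  freezing the state changes the field by at most \<open>field_bound A\<close> times the
  displacement, and integrating this error gives the quadratic term.\<close>

lemma trajectory_imp_integrated_control:
  fixes A :: "'i::finite \<Rightarrow> real^'d^'d"
  assumes x: "trajectory A x" and c: "\<And>t. 0 \<le> t \<Longrightarrow> norm (x t) \<le> c"
  obtains U where "U 0 = 0"
    "integrated_control A (field_bound A * c) (field_bound A * (field_bound A * c)) x U"
proof -
  let ?M = "field_bound A"
  obtain u where meas: "\<forall>i. u i \<in> borel_measurable (lebesgue_on {0..})"
    and u01': "\<forall>i. \<forall>t\<ge>0. 0 \<le> u i t \<and> u i t \<le> 1"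
    and sum1: "AE t in lebesgue_on {0..}. (\<Sum>i\<in>UNIV. u i t) = 1"
    and deriv: "AE t in lebesgue_on {0..}.
      (x has_vector_derivative (\<Sum>i\<in>UNIV. u i t *\<^sub>R (A i *v x t))) (at t within {0..})"
    using x unfolding trajectory_def by (elim conjE exE)
  have u01: "0 \<le> u i t \<and> u i t \<le> 1" if "0 \<le> t" for i t
    using u01' that by blast
  define w where "w = (\<lambda>t. \<chi> i. u i t)"
  have w: "\<bar>w t $ i\<bar> \<le> 1" if "0 \<le> t" for t i
    using u01[OF that, of i] by (simp add: w_def)
  have field: "(\<Sum>i\<in>UNIV. u i t *\<^sub>R (A i *v v)) = mixed_field A (w t) v" for t v
    by (simp add: mixed_field_def w_def)
  have c0: "0 \<le> c"
    using c[of 0] norm_ge_zero[of "x 0"] by linarith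
  have int: "u i integrable_on {s..t}" if "0 \<le> s" for i s t
  proof (rule measurable_bounded_by_integrable_imp_integrable_real)
    show "u i \<in> borel_measurable (lebesgue_on {s..t})"
      using that by (intro measurable_restrict_mono[OF meas[rule_format]]) auto
    show "(\<lambda>_. 1::real) integrable_on {s..t}"
      by (rule integrable_const_ivl)
  qed (use u01 that in auto)
  define U where "U = (\<lambda>t. \<chi> i. integral {0..t} (u i))"
  have hasint_u: "(u i has_integral (U t $ i - U s $ i)) {s..t}" if "0 \<le> s" "s \<le> t" for i s t
  proof -
    have "integral {s..t} (u i) = U t $ i - U s $ i"
      using Henstock_Kurzweil_Integration.integral_combine[OF that int[OF order_refl, of i]]
      by (simp add: U_def)
    then show ?thesis
      using integrable_integral[OF int[OF that(1), of i t]] by simp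
  qed
  have hasint_x: "((\<lambda>r. mixed_field A (w r) (x r)) has_integral (x t - x s)) {s..t}" if "0 \<le> s" "s \<le> t" for s t
  proof (rule fundamental_theorem_of_calculus_abs_continuous)
    show "abs_continuous_on {s..t} x"
      using x that unfolding trajectory_def by (auto intro: abs_continuous_on_subset[of "{0..t}"])
    show "negligible {r. 0 \<le> r \<and> \<not> (x has_vector_derivative (\<Sum>i\<in>UNIV. u i r *\<^sub>R (A i *v x r))) (at r within {0..})}"
      using deriv by (rule AE_lebesgue_on_nonneg_negligible)
    fix r assume "r \<in> {s..t} - {r. 0 \<le> r \<and> \<not> (x has_vector_derivative (\<Sum>i\<in>UNIV. u i r *\<^sub>R (A i *v x r))) (at r within {0..})}"
    then have "(x has_vector_derivative mixed_field A (w r) (x r)) (at r within {0..})"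
      using that by (auto simp: field)
    then show "(x has_vector_derivative mixed_field A (w r) (x r)) (at r within {s..t})"
      by (rule has_vector_derivative_within_subset) (use that in auto)
  qed (use that in auto)
  have lip0: "norm (x t - x s) \<le> ?M * c * (t - s)" if "0 \<le> s" "s \<le> t" for s t
  proof -
    have "norm (x t - x s) \<le> ?M * c * measure lborel {s..t}"
    proof (rule has_integral_bound_real[where S = "{}", OF _ finite.emptyI hasint_x[OF that]])
      show "0 \<le> ?M * c"
        using field_bound_nonneg[of A] c0 by simp
      fix r assume r: "r \<in> {s..t} - {}"
      then have "norm (mixed_field A (w r) (x r)) \<le> 1 * ?M * norm (x r)"
        using w that by (intro norm_mixed_field_le) auto
      also have "\<dots> \<le> ?M * c"
        using c[of r] r that field_bound_nonneg[of A] by (auto intro!: mult_left_mono)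
      finally show "norm (mixed_field A (w r) (x r)) \<le> ?M * c" .
    qed
    then show ?thesis using that by simp
  qed
  have lip: "norm (x t - x s) \<le> ?M * c * \<bar>t - s\<bar>" if "0 \<le> s" "0 \<le> t" for s t
    using lip0[of s t] lip0[of t s] that by (cases "s \<le> t") (auto simp: norm_minus_commute)
  \<comment> \<open>The freezing point \<open>p\<close> may be anywhere in the interval; its right
    end serves the case of time running backwards.\<close>
  have quad0: "norm (x t - x s - mixed_field A (U t - U s) (x p)) \<le> ?M * (?M * c) * (t - s)\<^sup>2"
    if "0 \<le> s" "s \<le> t" "p \<in> {s..t}" for s t p
  proof -
    have "((\<lambda>r. mixed_field A (w r) (x p)) has_integral mixed_field A (U t - U s) (x p)) {s..t}"
      unfolding mixed_field_def w_def using hasint_u[OF that(1,2)]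
      by (intro has_integral_sum) (auto intro!: has_integral_scaleR_left)
    from has_integral_diff[OF hasint_x[OF that(1,2)] this]
    have int: "((\<lambda>r. mixed_field A (w r) (x r - x p)) has_integral
       (x t - x s - mixed_field A (U t - U s) (x p))) {s..t}"
      by (simp add: mixed_field_diff)
    have "norm (x t - x s - mixed_field A (U t - U s) (x p)) \<le> (?M * (?M * c * (t - s))) * measure lborel {s..t}"
    proof (rule has_integral_bound_real[where S = "{}", OF _ finite.emptyI int])
      show "0 \<le> ?M * (?M * c * (t - s))"
        using field_bound_nonneg[of A] c0 that by simp
      fix r assume r: "r \<in> {s..t} - {}"
      then have "norm (mixed_field A (w r) (x r - x p)) \<le> 1 * ?M * norm (x r - x p)"
        using w that by (intro norm_mixed_field_le) auto
      also have "\<dots> \<le> 1 * ?M * (?M * c * \<bar>r - p\<bar>)"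
        using lip[of p r] r that field_bound_nonneg[of A] by (intro mult_left_mono) auto
      also have "\<dots> \<le> 1 * ?M * (?M * c * (t - s))"
        using r that field_bound_nonneg[of A] c0 by (intro mult_left_mono) auto
      finally show "norm (mixed_field A (w r) (x r - x p)) \<le> ?M * (?M * c * (t - s))" by simp
    qed
    then show ?thesis
      using that by (simp add: power2_eq_square mult.assoc)
  qed
  have quad: "norm (x t - x s - mixed_field A (U t - U s) (x s)) \<le> ?M * (?M * c) * (t - s)\<^sup>2"
    if "0 \<le> s" "0 \<le> t" for s t
  proof (cases "s \<le> t")
    case False
    have "mixed_field A (U t - U s) (x s) = - mixed_field A (U s - U t) (x s)"
      by (simp flip: mixed_field_minus)
    then have "norm (x t - x s - mixed_field A (U t - U s) (x s)) = norm (x s - x t - mixed_field A (U s - U t) (x s))"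
      by (metis (no_types, lifting) minus_diff_eq minus_diff_minus norm_minus_commute)
    then show ?thesis
      using quad0[of t s s] that False by (simp add: power2_commute)
  qed (use quad0[of s t s] that in auto)
  have mono: "U s $ i \<le> U t $ i" if "0 \<le> s" "s \<le> t" for s t i
    using has_integral_nonneg[OF hasint_u[OF that, of i]] u01 that by auto
  have sum0: "(\<Sum>i\<in>UNIV. U t $ i - U s $ i) = t - s" if "0 \<le> s" "s \<le> t" for s t
  proof -
    have "((\<lambda>r. \<Sum>i\<in>UNIV. u i r) has_integral (\<Sum>i\<in>UNIV. U t $ i - U s $ i)) {s..t}"
      using hasint_u[OF that] by (intro has_integral_sum) auto
    moreover have "((\<lambda>r. \<Sum>i\<in>UNIV. u i r) has_integral (t - s)) {s..t}"
    proof (rule has_integral_spike[OF AE_lebesgue_on_nonneg_negligible[OF sum1]])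
      show "((\<lambda>_. 1::real) has_integral (t - s)) {s..t}"
        using has_integral_const_real[of "1::real" s t] that by simp
    qed (use that in auto)
    ultimately show ?thesis
      by (rule has_integral_unique)
  qed
  have sum: "(\<Sum>i\<in>UNIV. U t $ i - U s $ i) = t - s" if "0 \<le> s" "0 \<le> t" for s t
    using sum0[of s t] sum0[of t s] that by (cases "s \<le> t") (simp_all add: sum_subtractf)
  show thesis
  proof (rule that)
    show "U 0 = 0"
      by (simp add: U_def vec_eq_iff)
    show "integrated_control A (?M * c) (?M * (?M * c)) x U"
      unfolding integrated_control_def using lip quad mono sum by blast
  qed
qed

section \<open>From integrated controls back to trajectories\<close>

lemma lipschitz_imp_abs_continuous_on:
  assumes "L-lipschitz_on S f"
  shows "abs_continuous_on S f"
  unfolding abs_continuous_on_def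
proof (intro allI impI)
  fix e :: real assume "e > 0"
  have L: "L \<ge> 0" using assms by (rule lipschitz_on_nonneg)
  have "(\<Sum>k<n. norm (f (b k) - f (a k))) < e"
    if *: "(\<forall>k<n. a k \<le> b k \<and> {a k..b k} \<subseteq> S) \<and>
        disjoint_family_on (\<lambda>k. {a k<..<b k}) {..<n} \<and> (\<Sum>k<n. b k - a k) < e / (L + 1)"
    for n and a b :: "nat \<Rightarrow> real"
  proof -
    have "(\<Sum>k<n. norm (f (b k) - f (a k))) \<le> (\<Sum>k<n. L * (b k - a k))"
    proof (rule sum_mono)
      fix k assume "k \<in> {..<n}"
      then have "a k \<le> b k" "{a k..b k} \<subseteq> S" using * by auto
      moreover from this have "a k \<in> S" "b k \<in> S"
        by (metis atLeastAtMost_iff order_refl subsetD)+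
      ultimately show "norm (f (b k) - f (a k)) \<le> L * (b k - a k)"
        using lipschitz_onD[OF assms, of "b k" "a k"] by (auto simp: dist_norm)
    qed
    also have "\<dots> \<le> (L + 1) * (\<Sum>k<n. b k - a k)"
      using * by (auto simp: sum_distrib_left intro!: sum_mono mult_right_mono)
    also have "\<dots> < e"
      using * L by (simp add: field_simps)
    finally show ?thesis .
  qed
  then show "\<exists>\<delta>>0. \<forall>(n::nat) a b. (\<forall>k<n. a k \<le> b k \<and> {a k..b k} \<subseteq> S) \<and>
        disjoint_family_on (\<lambda>k. {a k<..<b k}) {..<n} \<and> (\<Sum>k<n. b k - a k) < \<delta> \<longrightarrow>
        (\<Sum>k<n. norm (f (b k) - f (a k))) < e"
    using \<open>e > 0\<close> L by (intro exI[of _ "e / (L + 1)"]) auto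
qed

lemma has_vector_derivative_zero_quadratic:
  fixes g :: "real \<Rightarrow> 'a::real_normed_vector"
  assumes "\<And>s. s \<in> S \<Longrightarrow> norm (g s - g t) \<le> C * (s - t)\<^sup>2"
  shows "(g has_vector_derivative 0) (at t within S)"
  unfolding has_vector_derivative_def has_derivative_within_alt
proof (intro conjI allI impI)
  fix e :: real assume "e > 0"
  show "\<exists>d>0. \<forall>s\<in>S. norm (s - t) < d \<longrightarrow> norm (g s - g t - (s - t) *\<^sub>R 0) \<le> e * norm (s - t)"
  proof (intro exI[of _ "e / (\<bar>C\<bar> + 1)"] conjI ballI impI)
    fix s assume s: "s \<in> S" "norm (s - t) < e / (\<bar>C\<bar> + 1)"
    have "C * (s - t)\<^sup>2 \<le> (\<bar>C\<bar> + 1) * (s - t)\<^sup>2"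
      by (intro mult_right_mono) auto
    then have "norm (g s - g t) \<le> (\<bar>C\<bar> + 1) * (s - t)\<^sup>2"
      using assms[OF s(1)] by linarith
    also have "\<dots> = ((\<bar>C\<bar> + 1) * norm (s - t)) * norm (s - t)"
      by (simp add: power2_eq_square)
    also have "\<dots> \<le> e * norm (s - t)"
      using s(2) by (intro mult_right_mono) (auto simp: field_simps)
    finally show "norm (g s - g t - (s - t) *\<^sub>R 0) \<le> e * norm (s - t)" by simp
  qed (use \<open>e > 0\<close> in auto)
qed simp

text \<open>The components of \<open>U\<close> are monotone and 1-Lipschitz, hence differentiable
  almost everywhere. At such a time the quadratic inequality transfers the derivative of
  \<open>U\<close> to \<open>x\<close>.\<close>

lemma integrated_control_imp_trajectory:
  fixes A :: "'i::finite \<Rightarrow> real^'d^'d"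
  assumes xU: "integrated_control A L C x U"
  shows "trajectory A x"
proof -
  \<comment> \<open>Extension to the whole line, constant on the negative axis. The sum of the
    \<open>V i\<close> has a kink at 0, and 0 is put into the exceptional set
    \<open>E\<close>.\<close>
  define V where "V = (\<lambda>i t. U (max 0 t) $ i)"
  have V_lip: "1-lipschitz_on UNIV (V i)" for i
  proof (rule lipschitz_onI)
    fix s t :: real
    have "\<bar>V i t - V i s\<bar> \<le> \<bar>max 0 t - max 0 s\<bar>"
      unfolding V_def by (rule integrated_control_component_bound[OF xU]) auto
    then show "dist (V i s) (V i t) \<le> 1 * dist s t"
      by (auto simp: dist_real_def)
  qed simp
  have V_mono: "mono (V i)" for i
    unfolding V_def using integrated_controlD(3)[OF xU] by (intro monoI) auto
  define E where "E = insert 0 (\<Union>i. {t. \<not> V i differentiable (at t)})"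
  have "negligible E"
  proof -
    have "negligible (\<Union>i. {t. \<not> V i differentiable (at t)})"
      by (intro negligible_Union) (auto intro!: lipschitz_mono_differentiable_ae[OF V_mono V_lip])
    then show ?thesis by (simp add: E_def)
  qed
  \<comment> \<open>The control is a sequential limit of forward quotients, which makes it
    measurable; clamping keeps it in [0,1] even where the sequence diverges and \<open>lim\<close>
    is arbitrary.\<close>
  define q where "q = (\<lambda>i t n. (V i (t + 1 / Suc n) - V i t) * Suc n)"
  define u where "u = (\<lambda>i t. max 0 (min 1 (lim (q i t))))"
  have [measurable]: "V i \<in> borel_measurable borel" for i
    using V_lip by (intro borel_measurable_continuous_onI lipschitz_on_continuous_on)
  have u_meas: "u i \<in> borel_measurable (lebesgue_on {0..})" for i
  proof -
    have "u i \<in> borel_measurable borel"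
      unfolding u_def q_def by measurable
    then show ?thesis
      by (intro measurable_restrict_space1 measurable_completion) simp
  qed
  have D: "(V i has_real_derivative u i t) (at t) \<and> q i t \<longlonglongrightarrow> u i t" if "0 \<le> t" "t \<notin> E" for i t
  proof -
    have "V i differentiable (at t)"
      using that by (auto simp: E_def)
    then obtain D where D: "(V i has_real_derivative D) (at t)"
      by (auto simp: real_differentiable_def)
    have "(\<lambda>n. (V i (t + 1 / Suc n) - V i t) / (1 / Suc n)) \<longlonglongrightarrow> D"
    proof (rule filterlim_compose[OF D[unfolded DERIV_def]])
      show "filterlim (\<lambda>n. 1 / real (Suc n)) (at 0) sequentially"
        using LIMSEQ_inverse_real_of_nat by (auto simp: filterlim_at inverse_eq_divide)
    qed
    then have qD: "q i t \<longlonglongrightarrow> D"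
      by (simp add: q_def)
    have "0 \<le> q i t n \<and> q i t n \<le> 1" for n
    proof
      show "0 \<le> q i t n"
        using monoD[OF V_mono, of t "t + 1 / Suc n" i] by (simp add: q_def)
      have "V i (t + 1 / Suc n) - V i t \<le> 1 / Suc n"
        using lipschitz_onD[OF V_lip, of "t + 1 / Suc n" t i] by (simp add: dist_real_def)
      then have "(V i (t + 1 / Suc n) - V i t) * Suc n \<le> 1 / Suc n * Suc n"
        by (intro mult_right_mono) auto
      then show "q i t n \<le> 1"
        by (simp add: q_def)
    qed
    then have "0 \<le> D" "D \<le> 1"
      using qD by (auto intro: LIMSEQ_le_const LIMSEQ_le_const2)
    then have "u i t = D"
      using limI[OF qD] by (simp add: u_def)
    then show ?thesis
      using D qD by simp
  qed
  have sum1: "(\<Sum>i\<in>UNIV. u i t) = 1" if "0 \<le> t" "t \<notin> E" for t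
  proof -
    have "(\<lambda>n. \<Sum>i\<in>UNIV. q i t n) \<longlonglongrightarrow> (\<Sum>i\<in>UNIV. u i t)"
      using D[OF that] by (intro tendsto_sum) auto
    moreover have "(\<Sum>i\<in>UNIV. q i t n) = 1" for n
      using integrated_controlD(4)[OF xU, of t "t + 1 / Suc n"] that
      by (simp add: q_def V_def flip: sum_distrib_right)
    ultimately show ?thesis
      by (simp add: LIMSEQ_const_iff)
  qed
  have deriv: "(x has_vector_derivative (\<Sum>i\<in>UNIV. u i t *\<^sub>R (A i *v x t))) (at t within {0..})"
    if "0 \<le> t" "t \<notin> E" for t
  proof -
    \<comment> \<open>\<open>y\<close> varies the control with the state frozen at
      \<open>x t\<close>; \<open>x - y\<close> is then quadratically flat at \<open>t\<close>, so
      \<open>x\<close> and \<open>y\<close> have the same derivative there.\<close>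
    define y where "y = (\<lambda>s. \<Sum>i\<in>UNIV. V i s *\<^sub>R (A i *v x t))"
    have "(y has_vector_derivative (\<Sum>i\<in>UNIV. u i t *\<^sub>R (A i *v x t))) (at t within {0..})"
      unfolding y_def
    proof (rule has_vector_derivative_sum)
      fix i
      have "(V i has_real_derivative u i t) (at t within {0..})"
        using D[OF that, of i] by (blast intro: has_field_derivative_at_within)
      then show "((\<lambda>s. V i s *\<^sub>R (A i *v x t)) has_vector_derivative u i t *\<^sub>R (A i *v x t)) (at t within {0..})"
        by (auto intro!: derivative_eq_intros)
    qed
    moreover have "((\<lambda>s. x s - y s) has_vector_derivative 0) (at t within {0..})"
    proof (rule has_vector_derivative_zero_quadratic)
      fix s :: real assume s: "s \<in> {0..}"
      have eq: "(x s - y s) - (x t - y t) = x s - x t - mixed_field A (U s - U t) (x t)"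
        using s that by (simp add: y_def V_def mixed_field_def scaleR_diff_left sum_subtractf)
      show "norm ((x s - y s) - (x t - y t)) \<le> C * (s - t)\<^sup>2"
        unfolding eq using integrated_controlD(2)[OF xU, of t s] s that by simp
    qed
    ultimately have "((\<lambda>s. y s + (x s - y s)) has_vector_derivative
        (\<Sum>i\<in>UNIV. u i t *\<^sub>R (A i *v x t)) + 0) (at t within {0..})"
      by (rule has_vector_derivative_add)
    then show ?thesis by simp
  qed
  have AE: "AE t in lebesgue_on {0..}. P t" if "\<And>t. 0 \<le> t \<Longrightarrow> t \<notin> E \<Longrightarrow> P t" for P
  proof -
    have "AE t in lebesgue. t \<in> {0..} \<longrightarrow> P t"
      unfolding eventually_ae_filter_negligible using \<open>negligible E\<close> that by (intro exI[of _ E]) auto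
    then show ?thesis
      by (subst AE_restrict_space_iff) auto
  qed
  have "norm (x 1 - x 0) \<le> L"
    using integrated_controlD(1)[OF xU, of 0 1] by simp
  then have "L \<ge> 0"
    by (rule order_trans[OF norm_ge_zero])
  then have "L-lipschitz_on {0..T} x" for T
    using integrated_controlD(1)[OF xU] by (intro lipschitz_onI) (auto simp: dist_norm norm_minus_commute abs_minus_commute)
  then have "abs_continuous_on {0..T} x" for T
    by (rule lipschitz_imp_abs_continuous_on)
  moreover have "0 \<le> u i t \<and> u i t \<le> 1" for i t
    by (auto simp: u_def)
  moreover have "AE t in lebesgue_on {0..}. (\<Sum>i\<in>UNIV. u i t) = 1"
    by (rule AE) (rule sum1)
  moreover have "AE t in lebesgue_on {0..}.
      (x has_vector_derivative (\<Sum>i\<in>UNIV. u i t *\<^sub>R (A i *v x t))) (at t within {0..})"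
    by (rule AE) (rule deriv)
  ultimately show ?thesis
    unfolding trajectory_def by (intro conjI exI[of _ u] allI impI u_meas) simp_all
qed

section \<open>Compactness of trajectories with integrated controls\<close>

text \<open>The Arzela-Ascoli argument: a diagonal subsequence converges at the nonnegative
  rationals, and the common Lipschitz constant carries the Cauchy property to all times.\<close>

lemma equi_lipschitz_convergent_subsequence:
  fixes w :: "nat \<Rightarrow> real \<Rightarrow> 'b::{banach,heine_borel}"
  assumes lip: "\<And>n s t. 0 \<le> s \<Longrightarrow> 0 \<le> t \<Longrightarrow> norm (w n t - w n s) \<le> L * \<bar>t - s\<bar>"
    and bound: "\<And>n. norm (w n 0) \<le> B"
  obtains k :: "nat \<Rightarrow> nat" where "strict_mono k" "\<And>t. 0 \<le> t \<Longrightarrow> convergent (\<lambda>n. w (k n) t)"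
proof -
  have "norm (w 0 1 - w 0 0) \<le> L"
    using lip[of 0 1 0] by simp
  then have "0 \<le> L"
    by (rule order_trans[OF norm_ge_zero])
  have "0 \<le> B"
    using bound[of 0] norm_ge_zero[of "w 0 0"] by linarith
  let ?S = "\<rat> \<inter> {0::real..}"
  \<comment> \<open>The values may grow linearly in \<open>t\<close>; division by
    \<open>1 + t\<close> gives the bound uniform in \<open>t\<close> that the diagonal extraction
    asks for.\<close>
  have scaled: "norm (w n t /\<^sub>R (1 + t)) \<le> B + L" if "t \<in> ?S" for n t
  proof -
    have t: "0 \<le> t" using that by simp
    have "norm (w n t) \<le> norm (w n 0) + norm (w n t - w n 0)"
      by (rule norm_triangle_sub)
    also have "\<dots> \<le> B + L * t"
      using bound[of n] lip[of 0 t n] t by auto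
    also have "\<dots> \<le> (B + L) * (1 + t)"
      using t \<open>0 \<le> L\<close> \<open>0 \<le> B\<close> by (simp add: algebra_simps)
    finally show ?thesis
      using t by (simp add: field_simps)
  qed
  have "countable ?S"
    using countable_rat by (rule countable_subset[rotated]) simp
  obtain k :: "nat \<Rightarrow> nat" where k: "strict_mono k"
    "\<forall>t\<in>?S. \<exists>l. (\<lambda>n. w (k n) t /\<^sub>R (1 + t)) \<longlonglongrightarrow> l"
  proof (rule function_convergent_subsequence[OF \<open>countable ?S\<close> scaled])
    fix k :: "nat \<Rightarrow> nat"
    assume "strict_mono k" "\<And>t. t \<in> ?S \<Longrightarrow> \<exists>l. (\<lambda>n. w (k n) t /\<^sub>R (1 + t)) \<longlonglongrightarrow> l"
    then show thesis by (intro that[of k] ballI)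
  qed
  have rat: "Cauchy (\<lambda>n. w (k n) t)" if t: "t \<in> ?S" for t
  proof -
    obtain l where "(\<lambda>n. w (k n) t /\<^sub>R (1 + t)) \<longlonglongrightarrow> l"
      using bspec[OF k(2) t] by blast
    then have "(\<lambda>n. (1 + t) *\<^sub>R (w (k n) t /\<^sub>R (1 + t))) \<longlonglongrightarrow> (1 + t) *\<^sub>R l"
      by (intro tendsto_intros)
    moreover have "1 + t \<noteq> 0" using t by auto
    ultimately show ?thesis
      by (auto intro: LIMSEQ_imp_Cauchy)
  qed
  have "convergent (\<lambda>n. w (k n) t)" if t: "0 \<le> t" for t
  proof (rule Cauchy_convergent, rule metric_CauchyI)
    fix e :: real assume "e > 0"
    define d where "d = e / (3 * (L + 1))"
    have "d > 0" using \<open>e > 0\<close> \<open>0 \<le> L\<close> by (simp add: d_def)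
    then obtain q where q: "q \<in> \<rat>" "t < q" "q < t + d"
      using Rats_dense_in_real[of t "t + d"] by auto
    have "L * d \<le> e / 3"
      using \<open>e > 0\<close> \<open>0 \<le> L\<close> by (simp add: d_def field_simps)
    then have near: "dist (w n t) (w n q) \<le> e / 3" for n
      using lip[of q t n] q t mult_left_mono[of "\<bar>t - q\<bar>" d L] \<open>0 \<le> L\<close> by (simp add: dist_norm)
    obtain M where M: "\<And>m n. m \<ge> M \<Longrightarrow> n \<ge> M \<Longrightarrow> dist (w (k m) q) (w (k n) q) < e / 3"
      using metric_CauchyD[OF rat[of q], of "e / 3"] q t \<open>e > 0\<close> by auto
    show "\<exists>M. \<forall>m\<ge>M. \<forall>n\<ge>M. dist (w (k m) t) (w (k n) t) < e"
    proof (intro exI[of _ M] allI impI)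
      fix m n assume "M \<le> m" "M \<le> n"
      then show "dist (w (k m) t) (w (k n) t) < e"
        using M[of m n] near[of "k m"] near[of "k n"]
          dist_triangle[of "w (k m) t" "w (k n) t" "w (k m) q"] dist_triangle[of "w (k m) q" "w (k n) t" "w (k n) q"]
        by (simp add: dist_commute)
    qed
  qed
  then show thesis using k(1) that by blast
qed

lemma integrated_control_compact:
  fixes A :: "'i::finite \<Rightarrow> real^'d^'d"
  assumes xU: "\<And>n. integrated_control A L C (x n) (U n)"
    and init: "\<And>n. U n 0 = 0" "\<And>n. norm (x n 0) \<le> c"
  obtains k :: "nat \<Rightarrow> nat" and x' U' where "strict_mono k" "integrated_control A L C x' U'"
    "\<And>t. 0 \<le> t \<Longrightarrow> (\<lambda>n. x (k n) t) \<longlonglongrightarrow> x' t"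
proof -
  \<comment> \<open>State and integrated control are paired so that one subsequence serves
    both.\<close>
  define w where "w = (\<lambda>n t. (x n t, U n t))"
  have lip: "norm (w n t - w n s) \<le> (L + real CARD('i)) * \<bar>t - s\<bar>" if "0 \<le> s" "0 \<le> t" for n s t
  proof -
    have "norm (U n t - U n s) \<le> (\<Sum>i\<in>UNIV. \<bar>(U n t - U n s) $ i\<bar>)"
      by (rule norm_le_l1_cart)
    also have "\<dots> \<le> real CARD('i) * \<bar>t - s\<bar>"
      using integrated_control_component_bound[OF xU that] by (intro sum_bounded_above) auto
    finally have "norm (U n t - U n s) \<le> real CARD('i) * \<bar>t - s\<bar>" .
    moreover have "norm (w n t - w n s) \<le> norm (x n t - x n s) + norm (U n t - U n s)"
      by (simp add: w_def norm_Pair_le)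
    ultimately show ?thesis
      using integrated_controlD(1)[OF xU that, of n] by (simp add: algebra_simps)
  qed
  have "norm (w n 0) \<le> c" for n
    using init by (simp add: w_def norm_Pair)
  then obtain k :: "nat \<Rightarrow> nat" where k: "strict_mono k" "\<And>t. 0 \<le> t \<Longrightarrow> convergent (\<lambda>n. w (k n) t)"
    using equi_lipschitz_convergent_subsequence[of w, OF lip] by blast
  define w' where "w' = (\<lambda>t. lim (\<lambda>n. w (k n) t))"
  have w': "(\<lambda>n. w (k n) t) \<longlonglongrightarrow> w' t" if "0 \<le> t" for t
    unfolding w'_def using k(2)[OF that] by (simp add: convergent_LIMSEQ_iff)
  define x' where "x' = (\<lambda>t. fst (w' t))"
  define U' where "U' = (\<lambda>t. snd (w' t))"
  have x': "(\<lambda>n. x (k n) t) \<longlonglongrightarrow> x' t" if "0 \<le> t" for t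
    using tendsto_fst[OF w'[OF that]] by (simp add: x'_def w_def)
  have U': "(\<lambda>n. U (k n) t) \<longlonglongrightarrow> U' t" if "0 \<le> t" for t
    using tendsto_snd[OF w'[OF that]] by (simp add: U'_def w_def)
  have "integrated_control A L C x' U'"
    unfolding integrated_control_def
  proof (intro allI impI conjI)
    fix s t :: real assume s: "0 \<le> s" and t: "0 \<le> t"
    show "norm (x' t - x' s) \<le> L * \<bar>t - s\<bar>"
      using integrated_controlD(1)[OF xU s t]
      by (intro LIMSEQ_le_const2[OF tendsto_norm[OF tendsto_diff[OF x'[OF t] x'[OF s]]]]) auto
    have "(\<lambda>n. mixed_field A (U (k n) t - U (k n) s) (x (k n) s)) \<longlonglongrightarrow> mixed_field A (U' t - U' s) (x' s)"
      unfolding mixed_field_def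
      by (intro tendsto_intros U'[OF t] U'[OF s] bounded_linear.tendsto[OF matrix_vector_mul_bounded_linear x'[OF s]])
    then show "norm (x' t - x' s - mixed_field A (U' t - U' s) (x' s)) \<le> C * (t - s)\<^sup>2"
      using integrated_controlD(2)[OF xU s t]
      by (intro LIMSEQ_le_const2[OF tendsto_norm[OF tendsto_diff[OF tendsto_diff[OF x'[OF t] x'[OF s]]]]]) auto
    have "(\<lambda>n. \<Sum>i\<in>UNIV. U (k n) t $ i - U (k n) s $ i) \<longlonglongrightarrow> (\<Sum>i\<in>UNIV. U' t $ i - U' s $ i)"
      by (intro tendsto_intros U'[OF t] U'[OF s])
    then show "(\<Sum>i\<in>UNIV. U' t $ i - U' s $ i) = t - s"
      using integrated_controlD(4)[OF xU s t] by (simp add: LIMSEQ_const_iff)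
    fix i assume "s \<le> t"
    then show "U' s $ i \<le> U' t $ i"
      using integrated_controlD(3)[OF xU s t]
      by (intro LIMSEQ_le[OF tendsto_vec_nth[OF U'[OF s]] tendsto_vec_nth[OF U'[OF t]]]) auto
  qed
  then show thesis
    using that k(1) x' by blast
qed

section \<open>Extremal trajectories\<close>

lemma is_norm_continuous:
  assumes "is_norm f"
  shows "continuous_on S f"
proof -
  have "convex_on UNIV f"
  proof (rule convex_onI)
    fix t :: real and x y :: "real^'a"
    assume "0 < t" "t < 1"
    have "f ((1 - t) *\<^sub>R x + t *\<^sub>R y) \<le> f ((1 - t) *\<^sub>R x) + f (t *\<^sub>R y)"
      using assms unfolding is_norm_def by blast
    also have "\<dots> = (1 - t) * f x + t * f y"
      using assms \<open>0 < t\<close> \<open>t < 1\<close> unfolding is_norm_def by simp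
    finally show "f ((1 - t) *\<^sub>R x + t *\<^sub>R y) \<le> (1 - t) * f x + t * f y" .
  qed simp
  then have "continuous_on UNIV f"
    by (rule convex_on_continuous[OF open_UNIV])
  then show ?thesis
    by (rule continuous_on_subset) simp
qed

lemma is_norm_equivalent:
  fixes f :: "real^'d \<Rightarrow> real"
  assumes f: "is_norm f"
  obtains m M where "0 < m" "0 < M" "\<And>v. m * norm v \<le> f v" "\<And>v. f v \<le> M * norm v"
proof -
  have ne: "sphere (0::real^'d) 1 \<noteq> {}" by simp
  obtain a where a: "a \<in> sphere 0 1" "\<forall>v\<in>sphere 0 1. f a \<le> f v"
    using continuous_attains_inf[OF compact_sphere ne is_norm_continuous[OF f]] by blast
  obtain b where b: "b \<in> sphere 0 1" "\<forall>v\<in>sphere 0 1. f v \<le> f b"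
    using continuous_attains_sup[OF compact_sphere ne is_norm_continuous[OF f]] by blast
  have pos: "0 < f v" if "v \<noteq> 0" for v
    using f that unfolding is_norm_def by (metis less_eq_real_def)
  have scale: "f v = norm v * f (v /\<^sub>R norm v)" if "v \<noteq> 0" for v
    using f that unfolding is_norm_def by simp
  have zero: "f 0 = 0"
    using f unfolding is_norm_def by blast
  show thesis
  proof
    show "0 < f a" "0 < f b"
      using a(1) b(1) by (auto intro!: pos)
    show "f a * norm v \<le> f v" for v
    proof (cases "v = 0")
      case False
      then have "f a \<le> f (v /\<^sub>R norm v)" using a(2) by simp
      then show ?thesis
        unfolding scale[OF False] by (simp add: mult.commute mult_left_mono)
    qed (simp add: zero)
    show "f v \<le> f b * norm v" for v
    proof (cases "v = 0")
      case False
      then have "f (v /\<^sub>R norm v) \<le> f b" using b(2) by simp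
      then show ?thesis
        unfolding scale[OF False] by (simp add: mult.commute mult_left_mono)
    qed (simp add: zero)
  qed
qed

section \<open>Uniform nonsingularity and short-time displacement\<close>

lemma mixed_field_eq_matrix: "mixed_field A w v = (\<Sum>i\<in>UNIV. w $ i *\<^sub>R A i) *v v"
proof -
  have "(\<Sum>i\<in>I. w $ i *\<^sub>R A i) *v v = (\<Sum>i\<in>I. w $ i *\<^sub>R (A i *v v))" if "finite I" for I
    using that by induction
      (simp_all add: matrix_vector_mult_add_rdistrib scaleR_matrix_vector_assoc)
  then show ?thesis
    by (simp add: mixed_field_def)
qed

text \<open>The norm of the field attains its minimum on the compact product of the weight simplex
  and the unit sphere. The minimum is positive since the convex combination there is nonsingular,
  and homogeneity extends the bound to all \<open>v\<close>.\<close>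

lemma mixed_field_bounded_below:
  fixes A :: "'i::finite \<Rightarrow> real^'d^'d"
  assumes inv: "\<And>w. (\<forall>i. 0 \<le> w i) \<and> (\<Sum>i\<in>UNIV. w i) = 1 \<Longrightarrow> invertible (\<Sum>i\<in>UNIV. w i *\<^sub>R A i)"
  obtains \<kappa> where "0 < \<kappa>"
    "\<And>w v. (\<And>i. 0 \<le> w $ i) \<Longrightarrow> (\<Sum>i\<in>UNIV. w $ i) = 1 \<Longrightarrow> \<kappa> * norm v \<le> norm (mixed_field A w v)"
proof -
  define W where "W = {w :: real^'i. (\<forall>i. 0 \<le> w $ i) \<and> (\<Sum>i\<in>UNIV. w $ i) = 1}"
  have "bounded W"
  proof (rule boundedI)
    fix w :: "real^'i" assume "w \<in> W"
    then show "norm w \<le> 1"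
      using norm_le_l1_cart[of w] by (simp add: W_def)
  qed
  moreover have "closed W"
    unfolding W_def
    by (intro closed_Collect_conj closed_Collect_all closed_Collect_le closed_Collect_eq continuous_intros)
  ultimately have "compact (W \<times> sphere (0::real^'d) 1)"
    by (intro compact_Times compact_sphere) (simp add: compact_eq_bounded_closed)
  moreover have "W \<times> sphere (0::real^'d) 1 \<noteq> {}"
  proof -
    have "axis undefined 1 \<in> W"
      by (auto simp: W_def axis_def)
    then show ?thesis by auto
  qed
  moreover have "continuous_on (W \<times> sphere 0 1) (\<lambda>z. norm (mixed_field A (fst z) (snd z)))"
    by (intro continuous_on_norm continuous_mixed_field)
  ultimately obtain z where z: "z \<in> W \<times> sphere 0 1"
    "\<forall>y\<in>W \<times> sphere 0 1. norm (mixed_field A (fst z) (snd z)) \<le> norm (mixed_field A (fst y) (snd y))"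
    by (rule continuous_attains_inf[elim_format]) blast
  obtain w0 v0 where [simp]: "z = (w0, v0)" by (cases z)
  let ?\<kappa> = "norm (mixed_field A w0 v0)"
  show thesis
  proof
    have "mixed_field A w0 v0 \<noteq> 0"
    proof
      assume "mixed_field A w0 v0 = 0"
      moreover have "invertible (\<Sum>i\<in>UNIV. w0 $ i *\<^sub>R A i)"
        using z(1) by (intro inv) (auto simp: W_def)
      ultimately have "v0 = 0"
        unfolding mixed_field_eq_matrix
        by (metis invertible_def matrix_left_invertible_ker)
      then show False using z(1) by simp
    qed
    then show "0 < ?\<kappa>" by simp
    fix w :: "real^'i" and v :: "real^'d"
    assume w: "\<And>i. 0 \<le> w $ i" "(\<Sum>i\<in>UNIV. w $ i) = 1"
    show "?\<kappa> * norm v \<le> norm (mixed_field A w v)"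
    proof (cases "v = 0")
      case False
      have "?\<kappa> \<le> norm (mixed_field A w (v /\<^sub>R norm v))"
        using z(2) w False by (auto simp: W_def)
      also have "\<dots> = norm (mixed_field A w v) / norm v"
        by (simp add: mixed_field_eq_matrix matrix_vector_mult_scaleR divide_inverse_commute)
      finally show ?thesis
        using False by (simp add: field_simps)
    qed simp
  qed
qed

text \<open>The averaged control \<open>w\<close> over \<open>[0,t]\<close> is a convex weight, so
  \<open>x t - x 0\<close> is \<open>t\<close> times a field bounded below by
  \<open>\<kappa> * norm (x 0)\<close>, up to the quadratic error.\<close>

lemma integrated_control_displacement:
  assumes xU: "integrated_control A L C x U"
    and \<kappa>: "\<And>w v. (\<And>i. 0 \<le> w $ i) \<Longrightarrow> (\<Sum>i\<in>UNIV. w $ i) = 1 \<Longrightarrow> \<kappa> * norm v \<le> norm (mixed_field A w v)"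
    and "0 < t"
  shows "t * (\<kappa> * norm (x 0) - C * t) \<le> norm (x t - x 0)"
proof -
  define w where "w = (1 / t) *\<^sub>R (U t - U 0)"
  have "\<kappa> * norm (x 0) \<le> norm (mixed_field A w (x 0))"
  proof (rule \<kappa>)
    show "0 \<le> w $ i" for i
      using integrated_controlD(3)[OF xU, of 0 t i] \<open>0 < t\<close> by (simp add: w_def)
    show "(\<Sum>i\<in>UNIV. w $ i) = 1"
      using integrated_controlD(4)[OF xU, of 0 t] \<open>0 < t\<close> by (simp add: w_def flip: sum_divide_distrib)
  qed
  moreover have "mixed_field A (U t - U 0) (x 0) = t *\<^sub>R mixed_field A w (x 0)"
    using \<open>0 < t\<close> by (simp add: w_def flip: mixed_field_scale)
  ultimately have "t * (\<kappa> * norm (x 0)) \<le> norm (mixed_field A (U t - U 0) (x 0))"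
    using \<open>0 < t\<close> by simp
  also have "\<dots> \<le> norm (x t - x 0) + norm (x t - x 0 - mixed_field A (U t - U 0) (x 0))"
    by (metis norm_minus_commute norm_triangle_sub add.commute)
  also have "\<dots> \<le> norm (x t - x 0) + C * t\<^sup>2"
    using integrated_controlD(2)[OF xU, of 0 t] \<open>0 < t\<close> by simp
  finally show ?thesis
    by (simp add: algebra_simps power2_eq_square)
qed

theorem theorem3p11:
  fixes A :: "'i::finite \<Rightarrow> real^'d^'d"
    and f :: "real^'d \<Rightarrow> real"
  assumes "has_uniform_rate A 0"
    and "barabanov_norm A f"
    and "odd CARD('d)"
    and "\<forall>w::'i \<Rightarrow> real. (\<forall>i. 0 \<le> w i) \<and> (\<Sum>i\<in>UNIV. w i) = 1
            \<longrightarrow> invertible (\<Sum>i\<in>UNIV. w i *\<^sub>R A i)"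
  shows "\<exists>x y. extremal A f x \<and> extremal A f y \<and> x 0 = y 0 \<and> (\<exists>t\<ge>0. x t \<noteq> y t)"
proof (rule ccontr)
  assume "\<not> ?thesis"
  then have uniq: "x t = y t" if "extremal A f x" "extremal A f y" "x 0 = y 0" "0 \<le> t" for x y t
    using that by blast
  have f: "is_norm f" and ex: "\<And>v. f v = 1 \<Longrightarrow> \<exists>x. x 0 = v \<and> extremal A f x"
    using assms(2) unfolding barabanov_norm_def by blast+
  define S where "S = {v. f v = 1}"
  have "\<forall>v\<in>S. \<exists>x. x 0 = v \<and> extremal A f x"
    using ex by (simp add: S_def)
  then obtain \<phi> where \<phi>: "\<And>v. v \<in> S \<Longrightarrow> \<phi> v 0 = v" "\<And>v. v \<in> S \<Longrightarrow> extremal A f (\<phi> v)"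
    using bchoice[of S "\<lambda>v x. x 0 = v \<and> extremal A f x"] by blast
  obtain m M where m: "0 < m" "\<And>v. m * norm v \<le> f v" and M: "0 < M" "\<And>v. f v \<le> M * norm v"
    using is_norm_equivalent[OF f] by metis
  obtain \<kappa> where \<kappa>: "0 < \<kappa>"
    "\<And>w v. (\<And>i. 0 \<le> w $ i) \<Longrightarrow> (\<Sum>i\<in>UNIV. w $ i) = 1 \<Longrightarrow> \<kappa> * norm v \<le> norm (mixed_field A w v)"
    using mixed_field_bounded_below[of A] assms(4) by blast
  \<comment> \<open>The unit sphere \<open>S\<close> of \<open>f\<close> lies in the Euclidean
    annulus with radii \<open>r\<close> and \<open>c\<close>. Hence \<open>L\<close> and
    \<open>C\<close> serve all extremal trajectories at once.\<close>
  define c where "c = 1 / m"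
  define r where "r = 1 / M"
  define L where "L = field_bound A * c"
  define C where "C = field_bound A * L"
  have "0 < r" "0 \<le> c" "0 \<le> L" "0 \<le> C"
    using m M field_bound_nonneg[of A] by (simp_all add: r_def c_def L_def C_def)
  have upper: "norm v \<le> c" and lower: "r \<le> norm v" if "f v = 1" for v
    using m(1) m(2)[of v] M(1) M(2)[of v] that by (simp_all add: c_def r_def field_simps)
  have control: "\<exists>U. U 0 = 0 \<and> integrated_control A L C x U" if "extremal A f x" for x
  proof -
    have x: "trajectory A x"
      using that by (simp add: extremal_def)
    have xc: "norm (x t) \<le> c" if "0 \<le> t" for t
      using \<open>extremal A f x\<close> upper that unfolding extremal_def by auto
    obtain U where "U 0 = 0" "integrated_control A L C x U"
      unfolding L_def C_def by (rule trajectory_imp_integrated_control[OF x xc])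
    then show ?thesis by blast
  qed
  \<comment> \<open>The first term ensures \<open>C * h < \<kappa> * r\<close>, which rules out a
    return to \<open>v\<close>; the second ensures \<open>L * h < r\<close>, which rules out
    reaching \<open>- v\<close>. Adding 1 makes both strict.\<close>
  define h where "h = min (\<kappa> * r / (C + 1)) (r / (L + 1))"
  have "0 < h"
    using \<kappa>(1) \<open>0 < r\<close> \<open>0 \<le> L\<close> \<open>0 \<le> C\<close> by (simp add: h_def)
  have "C * h < \<kappa> * r"
  proof -
    have "h \<le> \<kappa> * r / (C + 1)" by (simp add: h_def)
    then have "C * h + h \<le> \<kappa> * r" using \<open>0 \<le> C\<close> by (simp add: field_simps)
    then show ?thesis using \<open>0 < h\<close> by linarith
  qed
  have "L * h < r"
  proof -
    have "h \<le> r / (L + 1)" by (simp add: h_def)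
    then have "L * h + h \<le> r" using \<open>0 \<le> L\<close> by (simp add: field_simps)
    then show ?thesis using \<open>0 < h\<close> by linarith
  qed
  define g where "g = (\<lambda>v. \<phi> v h)"
  have gS: "g v \<in> S" if "v \<in> S" for v
    using \<phi>(2)[OF that] \<open>0 < h\<close> by (simp add: g_def S_def extremal_def)
  have contf: "continuous_on UNIV f"
    using f by (rule is_norm_continuous)
  have "compact S"
    unfolding compact_eq_bounded_closed
  proof
    show "bounded S"
      by (rule boundedI[of _ c]) (simp add: S_def upper)
    show "closed S"
      unfolding S_def by (intro closed_Collect_eq contf continuous_on_const)
  qed
  \<comment> \<open>By compactness of \<open>S\<close> a closed graph suffices. Along a convergent
    sequence in the graph, a subsequence of the trajectories converges to an extremal one starting
    at \<open>fst l\<close>, and uniqueness identifies its value at \<open>h\<close> with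
    \<open>g (fst l)\<close>.\<close>
  have "continuous_on S g"
  proof (rule continuous_from_closed_graph[OF \<open>compact S\<close>])
    show "closed ((\<lambda>v. (v, g v)) ` S)"
      unfolding closed_sequential_limits
    proof (intro allI impI)
      fix z l assume "(\<forall>n::nat. z n \<in> (\<lambda>v. (v, g v)) ` S) \<and> z \<longlonglongrightarrow> l"
      then have z: "\<forall>n. z n \<in> (\<lambda>v. (v, g v)) ` S" and lim: "z \<longlonglongrightarrow> l" by auto
      define v where "v = (\<lambda>n. fst (z n))"
      have v: "v n \<in> S" "snd (z n) = g (v n)" for n
        using z[rule_format, of n] by (auto simp: v_def)
      have "\<forall>n. \<exists>U. U 0 = 0 \<and> integrated_control A L C (\<phi> (v n)) U"
        using control[OF \<phi>(2)[OF v(1)]] by blast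
      then obtain U where U: "\<forall>n. U n 0 = 0 \<and> integrated_control A L C (\<phi> (v n)) (U n)"
        using choice[of "\<lambda>n U. U 0 = 0 \<and> integrated_control A L C (\<phi> (v n)) U"] by blast
      have "norm (\<phi> (v n) 0) \<le> c" for n
        using v(1)[of n] upper by (simp add: \<phi>(1) S_def)
      then obtain k x' U' where k: "strict_mono (k :: nat \<Rightarrow> nat)" and x': "integrated_control A L C x' U'"
        and conv: "\<And>t. 0 \<le> t \<Longrightarrow> (\<lambda>n. \<phi> (v (k n)) t) \<longlonglongrightarrow> x' t"
        using integrated_control_compact[of A L C "\<lambda>n. \<phi> (v n)" U c] U by blast
      have "extremal A f x'"
        unfolding extremal_def
      proof (intro conjI allI impI)
        show "trajectory A x'"
          using x' by (rule integrated_control_imp_trajectory)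
        fix t :: real assume t: "0 \<le> t"
        have "(\<lambda>n. f (\<phi> (v (k n)) t)) \<longlonglongrightarrow> f (x' t)"
          using contf conv[OF t] by (rule continuous_on_tendsto_compose) auto
        moreover have "f (\<phi> (v (k n)) t) = 1" for n
          using \<phi>(2)[OF v(1), of "k n"] t by (simp add: extremal_def)
        ultimately show "f (x' t) = 1"
          by (simp add: LIMSEQ_const_iff)
      qed
      have lim_k: "(\<lambda>n. z (k n)) \<longlonglongrightarrow> l"
        using LIMSEQ_subseq_LIMSEQ[OF lim k] by (simp add: o_def)
      have "(\<lambda>n. v (k n)) \<longlonglongrightarrow> fst l"
        unfolding v_def using lim_k by (rule tendsto_fst)
      moreover have "(\<lambda>n. v (k n)) \<longlonglongrightarrow> x' 0"
        using conv[of 0] v(1) by (simp add: \<phi>(1))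
      ultimately have l1: "fst l = x' 0"
        by (rule LIMSEQ_unique)
      have "(\<lambda>n. g (v (k n))) \<longlonglongrightarrow> snd l"
        using tendsto_snd[OF lim_k] by (simp add: v(2))
      moreover have "(\<lambda>n. g (v (k n))) \<longlonglongrightarrow> x' h"
        using conv[of h] \<open>0 < h\<close> by (simp add: g_def)
      ultimately have l2: "snd l = x' h"
        by (rule LIMSEQ_unique)
      have lS: "fst l \<in> S"
        using \<open>extremal A f x'\<close> by (simp add: l1 S_def extremal_def)
      have "\<phi> (fst l) 0 = x' 0" "0 \<le> h"
        using \<phi>(1)[OF lS] l1 \<open>0 < h\<close> by simp_all
      from uniq[OF \<phi>(2)[OF lS] \<open>extremal A f x'\<close> this]
      have "l = (fst l, g (fst l))"
        by (simp add: g_def l2[symmetric])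
      then show "l \<in> (\<lambda>v. (v, g v)) ` S"
        using lS by (rule image_eqI)
    qed
  qed (use gS in auto)
  have fpos: "0 < f u" if "norm u = 1" for u
    using m(1) m(2)[of u] that by simp
  have unitS: "u /\<^sub>R f u \<in> S" if "norm u = 1" for u
  proof -
    have "f (u /\<^sub>R f u) = \<bar>inverse (f u)\<bar> * f u"
      using f unfolding is_norm_def by blast
    then show ?thesis
      using fpos[OF that] by (simp add: S_def field_simps)
  qed
  \<comment> \<open>Radial rescaling by \<open>f\<close> moves the problem from \<open>S\<close> to
    the Euclidean sphere while keeping rays.\<close>
  have "continuous_on (sphere 0 1) (\<lambda>u. g (u /\<^sub>R f u))"
  proof (rule continuous_on_compose2[OF \<open>continuous_on S g\<close>])
    show "continuous_on (sphere 0 1) (\<lambda>u. u /\<^sub>R f u)"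
      using fpos by (intro continuous_intros continuous_on_subset[OF contf]) fastforce+
    show "(\<lambda>u. u /\<^sub>R f u) ` sphere 0 1 \<subseteq> S"
      using unitS by auto
  qed
  moreover have "odd DIM(real^'d)"
    using assms(3) by simp
  ultimately obtain u a where u: "norm u = 1" "g (u /\<^sub>R f u) = a *\<^sub>R u"
    using hairy_ball_radial_direction by blast
  define v where "v = u /\<^sub>R f u"
  have "v \<in> S" "f v = 1"
    using unitS[OF u(1)] by (auto simp: v_def S_def)
  have gv: "g v = (a * f u) *\<^sub>R v"
    using u fpos[OF u(1)] by (simp add: v_def)
  \<comment> \<open>Both \<open>v\<close> and \<open>g v\<close> have \<open>f\<close>-norm 1, so
    the factor on the ray is 1 or -1.\<close>
  have "f (g v) = \<bar>a * f u\<bar> * f v"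
    unfolding gv using f unfolding is_norm_def by blast
  then have "\<bar>a * f u\<bar> = 1"
    using gS[OF \<open>v \<in> S\<close>] \<open>f v = 1\<close> by (simp add: S_def)
  obtain U where U: "integrated_control A L C (\<phi> v) U"
    using control[OF \<phi>(2)[OF \<open>v \<in> S\<close>]] by blast
  have "r \<le> norm v"
    using lower[OF \<open>f v = 1\<close>] .
  have "g v \<noteq> v"
  proof
    assume "g v = v"
    then have "h * (\<kappa> * norm v - C * h) \<le> 0"
      using integrated_control_displacement[OF U \<kappa>(2) \<open>0 < h\<close>] \<phi>(1)[OF \<open>v \<in> S\<close>] by (simp add: g_def)
    then have "\<kappa> * norm v \<le> C * h"
      using \<open>0 < h\<close> by (simp add: mult_le_0_iff)
    moreover have "\<kappa> * r \<le> \<kappa> * norm v"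
      using \<kappa>(1) \<open>r \<le> norm v\<close> by simp
    ultimately show False
      using \<open>C * h < \<kappa> * r\<close> by linarith
  qed
  moreover have "g v \<noteq> - v"
  proof
    assume "g v = - v"
    then have "norm (- v - v) \<le> L * h"
      using integrated_controlD(1)[OF U, of 0 h] \<open>0 < h\<close> \<phi>(1)[OF \<open>v \<in> S\<close>] by (simp add: g_def)
    moreover have "norm (- v - v) = 2 * norm v"
      by (metis minus_add_distrib norm_minus_cancel norm_scaleR scaleR_2 abs_numeral uminus_add_conv_diff diff_conv_add_uminus)
    ultimately show False
      using \<open>L * h < r\<close> \<open>r \<le> norm v\<close> \<open>0 < r\<close> by linarith
  qed
  ultimately show False
    using \<open>\<bar>a * f u\<bar> = 1\<close> unfolding gv by (auto simp: abs_if split: if_splits)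
qed

end
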